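(* Let $X$ be a linear space with a Polish topology for which addition is continuous (e.g. $X=\mathbb{R}^d$). Let $\mu_{\mathrm c}$ be a probability measure on $\Gamma_X^\sharp$ and $\eta$ a probability measure on $\mathfrak{X}$, symmetric with respect to permutations of coordinates. Let $\mu_{\mathrm{cl}}$ be the distribution on $\Gamma_X^\sharp$ of the cluster point process with centers distributed according to $\mu_{\mathrm c}$ and with i.i.d. clusters governed by $\eta$, and let $\hat\mu$ be the probability measure on $\Gamma_{\mathcal Z}^\sharp$ obtained by attaching to the points of a $\mu_{\mathrm c}$-distributed configuration i.i.d. $\eta$-distributed vectors. Then $\mu_{\mathrm{cl}}$ is the push-forward of $\hat\mu$ under the map $\mathfrak q:\Gamma_{\mathcal Z}^\sharp\to\Gamma_X^\sharp$, that is, $$\mu_{\mathrm{cl}}=\mathfrak q^*\hat\mu\equiv\hat\mu\circ\mathfrak q^{-1}.$$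
   Context: For a Polish space $Y$, a generalized configuration in $Y$ is a countable aggregate of points of $Y$, possibly with multiplicities and accumulation points, identified with the $\{0,1,2,\dots,\infty\}$-valued measure $\gamma=\sum_i\delta_{y_i}$ with countable support. $\Gamma_Y^\sharp$ is the set of generalized configurations, with the $\sigma$-algebra generated by the sets $\{\gamma:\gamma(B)=n\}$, $B\subset Y$ Borel, $n\in\mathbb Z_+=\{0,1,2,\dots\}$. Sums, products and disjoint unions over $y\in\gamma$ count multiplicities. $\mathfrak X:=\bigsqcup_{n\in\mathbb Z_+\cup\{\infty\}}X^n$ with the disjoint union topology, where $X^0=\{\emptyset\}$ and $X^\infty$ is the space of infinite sequences; $y_i\in\bar y$ means that $y_i$ is a coordinate of $\bar y\in\mathfrak X$; $\bar y+x:=(y_1+x,y_2+x,\dots)$; $\mathcal Z:=X\times\mathfrak X$. The map $\mathfrak p:\mathfrak X\to\Gamma_X^\sharp$ is $\mathfrak p(\bar y)=\bigsqcup_{y_i\in\bar y}\{y_i\}$. The map $\mathfrak q:\mathcal Z\to\Gamma_X^\sharp$ is $\mathfrak q(x,\bar y):=\mathfrak p(\bar y+x)=\bigsqcup_{y_i\in\bar y}\{y_i+x\}$, lifted to $\mathfrak q:\Gamma_{\mathcal Z}^\sharp\to\Gamma_X^\sharp$ by $\mathfrak q(\hat\gamma):=\bigsqcup_{z\in\hat\gamma}\mathfrak q(z)$. Cluster process: let $\mu_0:=\eta\circ\mathfrak p^{-1}$ and $\mu_x(A):=\mu_0(A-x)$ for $x\in X$ and measurable $A\subset\Gamma_X^\sharp$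 ($A-x$ is $A$ translated by $-x$). A random configuration $\gamma_{\mathrm c}$ with distribution $\mu_{\mathrm c}$ is drawn; given $\gamma_{\mathrm c}$, independent random configurations $\gamma'_x$ with distributions $\mu_x$ are drawn for $x\in\gamma_{\mathrm c}$; $\mu_{\mathrm{cl}}$ is the distribution of $\gamma=\bigsqcup_{x\in\gamma_{\mathrm c}}\gamma'_x$, i.e. $\gamma(B)=\sum_{x\in\gamma_{\mathrm c}}\gamma'_x(B)$ for Borel $B\subset X$. $\hat\mu$ is the distribution of $\hat\gamma:=\bigsqcup_{x\in\gamma_{\mathrm c}}\{(x,\bar y_x)\}\in\Gamma_{\mathcal Z}^\sharp$, where $\gamma_{\mathrm c}\sim\mu_{\mathrm c}$ and, given $\gamma_{\mathrm c}$, the vectors $\bar y_x$ ($x\in\gamma_{\mathrm c}$) are i.i.d. with distribution $\eta$. *)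

theory Defs
  imports "HOL-Probability.Probability"
begin

text \<open>Configurations are represented by the measures they are identified with.  The disjoint union
  of configurations is the sum of measures; point multiplicities lie in {0, 1, ..., \<infinity>}.\<close>

definition superpose :: "'i set \<Rightarrow> 'a measure \<Rightarrow> ('i \<Rightarrow> 'a measure) \<Rightarrow> 'a measure" where
  "superpose I M \<nu> =
     measure_of (space M) (sets M) (\<lambda>B. \<integral>\<^sup>+ i. emeasure (\<nu> i) B \<partial>count_space I)"

text \<open>Only \<^term>\<open>space M\<close> and \<^term>\<open>sets M\<close> matter below: \<^term>\<open>M\<close> stands for the Borel space of a
  Polish space, and \<^term>\<open>return M y\<close> is the Dirac measure at \<^term>\<open>y\<close>.\<close>

definition gen_configs :: "'a measure \<Rightarrow> 'a measure set" where
  "gen_configs M = {superpose I M (\<lambda>i. return M (y i)) | (I :: nat set) y. y \<in> I \<rightarrow> space M}"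

definition config_space :: "'a measure \<Rightarrow> 'a measure measure" where
  "config_space M =
     sigma (gen_configs M)
       {{\<gamma> \<in> gen_configs M. emeasure \<gamma> B = of_nat n} | B (n :: nat). B \<in> sets M}"

text \<open>The points of a configuration with multiplicities: a point \<^term>\<open>x\<close> of multiplicity \<open>m\<close>
  is listed as the pairs \<open>(x, k)\<close> with \<open>k < m\<close>, so that sums, products and disjoint
  unions over the configuration are those indexed by this set.\<close>

definition config_points :: "'a measure \<Rightarrow> ('a \<times> nat) set" where
  "config_points \<gamma> = {(x, k). of_nat k < emeasure \<gamma> {x}}"

definition borel_of :: "'a topology \<Rightarrow> 'a measure" where
  "borel_of T = sigma (topspace T) {U. openin T U}"

text \<open>A finite or infinite vector is a pair \<open>(n, y)\<close> of its length \<open>n \<in> {0, 1, ..., \<infinity>}\<close>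
  and its family of coordinates indexed by \<open>{i. enat i < n}\<close>.\<close>

type_synonym 'a vect = "enat \<times> (nat \<Rightarrow> 'a)"

definition vect_topology :: "'a::topological_space vect topology" where
  "vect_topology = sum_topology (\<lambda>n. product_topology (\<lambda>_. euclidean) {i. enat i < n}) UNIV"

definition marked_topology :: "('a::topological_space \<times> 'a vect) topology" where
  "marked_topology = prod_topology euclidean vect_topology"

abbreviation vect_borel :: "'a::topological_space vect measure" where
  "vect_borel \<equiv> borel_of vect_topology"

abbreviation marked_borel :: "('a::topological_space \<times> 'a vect) measure" where
  "marked_borel \<equiv> borel_of marked_topology"

fun vect_shift :: "'a::plus \<Rightarrow> 'a vect \<Rightarrow> 'a vect" where
  "vect_shift x (n, y) = (n, \<lambda>i\<in>{i. enat i < n}. y i + x)"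

fun vect_permute :: "(nat \<Rightarrow> nat) \<Rightarrow> 'a vect \<Rightarrow> 'a vect" where
  "vect_permute \<pi> (n, y) = (n, y \<circ> \<pi>)"

text \<open>For \<open>n = \<infinity>\<close> all permutations of the indices are admitted; since finite permutations already
  force exchangeability, this is the same as invariance under the finite ones.\<close>

definition symmetric_vect_measure :: "'a vect measure \<Rightarrow> bool" where
  "symmetric_vect_measure \<eta> \<longleftrightarrow>
     (\<forall>n \<pi>. \<pi> permutes {i. enat i < n} \<longrightarrow>
       (\<forall>A\<in>sets \<eta>. A \<subseteq> {n} \<times> UNIV \<longrightarrow> emeasure \<eta> (vect_permute \<pi> ` A) = emeasure \<eta> A))"

fun vect_config :: "'a::topological_space vect \<Rightarrow> 'a measure" where
  "vect_config (n, y) = superpose {i. enat i < n} borel (\<lambda>i. return borel (y i))"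

fun marked_config :: "'a::{topological_space, plus} \<times> 'a vect \<Rightarrow> 'a measure" where
  "marked_config (x, v) = vect_config (vect_shift x v)"

definition marked_config_lift ::
  "('a::{topological_space, plus} \<times> 'a vect) measure \<Rightarrow> 'a measure" where
  "marked_config_lift \<gamma> = superpose (config_points \<gamma>) borel (\<lambda>(z, k). marked_config z)"

definition config_shift :: "'a::{topological_space, plus} \<Rightarrow> 'a measure \<Rightarrow> 'a measure" where
  "config_shift x \<gamma> = distr \<gamma> borel (\<lambda>y. y + x)"

definition centred_cluster :: "'a::topological_space vect measure \<Rightarrow> 'a measure measure" where
  "centred_cluster \<eta> = distr \<eta> (config_space borel) vect_config"

definition cluster_at ::
  "'a::{topological_space, group_add} vect measure \<Rightarrow> 'a \<Rightarrow> 'a measure measure" where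
  "cluster_at \<eta> x =
     measure_of (space (config_space borel)) (sets (config_space borel))
       (\<lambda>A. emeasure (centred_cluster \<eta>) (config_shift (- x) ` A))"

text \<open>In both definitions below the Giry bind performs the two-stage draw: first \<open>\<gamma>\<close>
  from \<open>\<mu>\<close>, then an independent family indexed by the points of \<open>\<gamma>\<close>, counted with multiplicity.\<close>

definition cluster_measure ::
  "'a measure measure \<Rightarrow> 'a::{topological_space, group_add} vect measure \<Rightarrow> 'a measure measure"
where
  "cluster_measure \<mu> \<eta> =
     Giry_Monad.bind \<mu> (\<lambda>\<gamma>.
       distr (\<Pi>\<^sub>M (x, k)\<in>config_points \<gamma>. cluster_at \<eta> x) (config_space borel)
         (\<lambda>\<omega>. superpose (config_points \<gamma>) borel \<omega>))"

definition marked_measure ::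
  "'a measure measure \<Rightarrow> 'a::topological_space vect measure \<Rightarrow> ('a \<times> 'a vect) measure measure"
where
  "marked_measure \<mu> \<eta> =
     Giry_Monad.bind \<mu> (\<lambda>\<gamma>.
       distr (\<Pi>\<^sub>M _\<in>config_points \<gamma>. \<eta>) (config_space marked_borel)
         (\<lambda>v. superpose (config_points \<gamma>) marked_borel
           (\<lambda>(x, k). return marked_borel (x, v (x, k)))))"

end

theory Submission
  imports Defs
begin

text \<open>Fix a configuration \<open>\<gamma>\<close> of centres.  Its i.i.d. marks, pushed forward coordinatewise by
  \<open>y \<mapsto> p(y + x)\<close>, are independent clusters with laws \<open>\<mu>\<^sub>x\<close>, because \<open>\<mu>\<^sub>x\<close> is the image of
  \<open>\<eta>\<close> under this map; and \<open>q\<close> turns the superposition of the marked points into the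
  superposition of these clusters.  So the two conditional laws given \<open>\<gamma>\<close> agree, and it remains to
  exchange \<open>q\<close> with the integration over \<open>\<gamma>\<close>, for which the marking kernel must be measurable.

  As \<open>\<gamma>\<close> need not be \<open>\<sigma>\<close>-finite, its points cannot be enumerated measurably.  Instead, the Laplace
  functional of the marked configuration is, by independence, \<open>exp (- \<integral> \<phi> d\<gamma>)\<close> with
  \<open>\<phi> x = - ln (\<integral> exp (- g (x, y)) d\<eta>)\<close>, which is measurable in \<open>\<gamma>\<close>, and the probabilities of
  the generating events are limits of combinations of Laplace functionals.\<close>


section \<open>Generalized configurations\<close>

lemma space_superpose [simp]: "space (superpose I M \<nu>) = space M"
  and sets_superpose [simp, measurable_cong]: "sets (superpose I M \<nu>) = sets M"
  by (simp_all add: superpose_def)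

text \<open>Countable additivity of the sum of measures is an exchange of two sums of nonnegative
  terms, which holds for index sets \<open>I\<close> of any size.\<close>

lemma emeasure_superpose:
  assumes \<nu>: "\<And>i. i \<in> I \<Longrightarrow> sets (\<nu> i) = sets M" and B: "B \<in> sets M"
  shows "emeasure (superpose I M \<nu>) B = (\<integral>\<^sup>+ i. emeasure (\<nu> i) B \<partial>count_space I)"
proof (rule emeasure_measure_of[OF superpose_def])
  show "countably_additive (sets (superpose I M \<nu>)) (\<lambda>B. \<integral>\<^sup>+ i. emeasure (\<nu> i) B \<partial>count_space I)"
  proof (rule countably_additiveI)
    fix A :: "nat \<Rightarrow> _ set"
    assume A: "range A \<subseteq> sets (superpose I M \<nu>)" "disjoint_family A"
    have "(\<Sum>n. \<integral>\<^sup>+ i. emeasure (\<nu> i) (A n) \<partial>count_space I)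
      = (\<integral>\<^sup>+ i. (\<Sum>n. emeasure (\<nu> i) (A n)) \<partial>count_space I)"
      by (simp add: nn_integral_suminf)
    also have "\<dots> = (\<integral>\<^sup>+ i. emeasure (\<nu> i) (\<Union>n. A n) \<partial>count_space I)"
      using A \<nu> by (intro nn_integral_cong suminf_emeasure) auto
    finally show "(\<Sum>n. \<integral>\<^sup>+ i. emeasure (\<nu> i) (A n) \<partial>count_space I)
      = (\<integral>\<^sup>+ i. emeasure (\<nu> i) (\<Union>n. A n) \<partial>count_space I)" .
  qed
qed (use B in \<open>auto simp: sets.space_closed positive_def\<close>)

lemma nn_integral_superpose:
  assumes \<nu>: "\<And>i. i \<in> I \<Longrightarrow> sets (\<nu> i) = sets M" and f: "f \<in> borel_measurable M"
  shows "(\<integral>\<^sup>+ x. f x \<partial>superpose I M \<nu>) = (\<integral>\<^sup>+ i. (\<integral>\<^sup>+ x. f x \<partial>\<nu> i) \<partial>count_space I)"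
  using f
proof (induction rule: borel_measurable_induct)
  case (cong f g)
  then have "integral\<^sup>N (superpose I M \<nu>) f = integral\<^sup>N (superpose I M \<nu>) g"
    by (intro nn_integral_cong) simp
  moreover have "(\<integral>\<^sup>+ i. integral\<^sup>N (\<nu> i) f \<partial>count_space I) = (\<integral>\<^sup>+ i. integral\<^sup>N (\<nu> i) g \<partial>count_space I)"
    using cong \<nu> by (intro nn_integral_cong) (auto dest: sets_eq_imp_space_eq)
  ultimately show ?case
    using cong by simp
next
  case (set A)
  then have "(\<integral>\<^sup>+ i. integral\<^sup>N (\<nu> i) (indicator A) \<partial>count_space I)
      = (\<integral>\<^sup>+ i. emeasure (\<nu> i) A \<partial>count_space I)"
    using \<nu> by (intro nn_integral_cong) auto
  with set show ?case
    using \<nu> by (simp add: emeasure_superpose)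
next
  case (mult u c)
  then have "(\<integral>\<^sup>+ i. (\<integral>\<^sup>+ x. c * u x \<partial>\<nu> i) \<partial>count_space I)
      = (\<integral>\<^sup>+ i. c * (\<integral>\<^sup>+ x. u x \<partial>\<nu> i) \<partial>count_space I)"
    using \<nu> by (intro nn_integral_cong nn_integral_cmult) (auto cong: measurable_cong_sets)
  with mult show ?case
    by (simp add: nn_integral_cmult)
next
  case (add u v)
  then have "(\<integral>\<^sup>+ i. (\<integral>\<^sup>+ x. v x + u x \<partial>\<nu> i) \<partial>count_space I)
      = (\<integral>\<^sup>+ i. (\<integral>\<^sup>+ x. v x \<partial>\<nu> i) + (\<integral>\<^sup>+ x. u x \<partial>\<nu> i) \<partial>count_space I)"
    using \<nu> by (intro nn_integral_cong nn_integral_add) (auto cong: measurable_cong_sets)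
  with add show ?case
    by (simp add: nn_integral_add)
next
  case (seq U)
  then have "(\<integral>\<^sup>+ i. (\<integral>\<^sup>+ x. (SUP n. U n) x \<partial>\<nu> i) \<partial>count_space I)
      = (\<integral>\<^sup>+ i. (SUP n. \<integral>\<^sup>+ x. U n x \<partial>\<nu> i) \<partial>count_space I)"
    using \<nu> unfolding SUP_apply
    by (intro nn_integral_cong nn_integral_monotone_convergence_SUP) (auto cong: measurable_cong_sets)
  also have "\<dots> = (SUP n. \<integral>\<^sup>+ i. (\<integral>\<^sup>+ x. U n x \<partial>\<nu> i) \<partial>count_space I)"
    using seq by (intro nn_integral_monotone_convergence_SUP)
      (auto simp: incseq_def le_fun_def intro!: nn_integral_mono)
  finally show ?case
    using seq by (simp add: nn_integral_monotone_convergence_SUP image_comp)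
qed

lemma superpose_cong:
  assumes "\<And>i. i \<in> I \<Longrightarrow> \<nu> i = \<nu>' i"
  shows "superpose I M \<nu> = superpose I M \<nu>'"
  using assms by (auto simp: superpose_def intro!: arg_cong[where f = "measure_of _ _"] nn_integral_cong)

text \<open>\<open>gen_configs\<close> lists points by sets of natural numbers; a countable index
  set of another type is renumbered through \<open>to_nat_on\<close>.\<close>

lemma gen_configs_superpose_return:
  assumes I: "countable I" and y: "y \<in> I \<rightarrow> space M"
  shows "superpose I M (\<lambda>i. return M (y i)) \<in> gen_configs M"
proof -
  let ?J = "to_nat_on I ` I"
  have bij: "bij_betw (from_nat_into I) ?J I"
    using I by (simp add: bij_betw_def inj_on_def image_image)
  have "superpose I M (\<lambda>i. return M (y i)) = superpose ?J M (\<lambda>j. return M (y (from_nat_into I j)))"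
    by (simp add: superpose_def
        nn_integral_bij_count_space[OF bij, where f = "\<lambda>i. emeasure (return M (y i)) _"])
  moreover have "(\<lambda>j. y (from_nat_into I j)) \<in> ?J \<rightarrow> space M"
    using y I by auto
  ultimately show ?thesis
    unfolding gen_configs_def
    by (auto intro!: exI[of _ ?J] exI[of _ "\<lambda>j. y (from_nat_into I j)"])
qed

lemma gen_configsE:
  assumes "\<gamma> \<in> gen_configs M"
  obtains I :: "nat set" and y where "y \<in> I \<rightarrow> space M" "\<gamma> = superpose I M (\<lambda>i. return M (y i))"
  using assms unfolding gen_configs_def by blast

lemma sets_gen_configs: "\<gamma> \<in> gen_configs M \<Longrightarrow> sets \<gamma> = sets M"
  by (auto elim: gen_configsE)

lemma nn_integral_count_space_UNIV:
  fixes f :: "'i \<Rightarrow> ennreal"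
  shows "(\<integral>\<^sup>+ i. f i \<partial>count_space I) = (\<integral>\<^sup>+ i. f i * indicator I i \<partial>count_space UNIV)"
  by (rule nn_integral_count_space_indicator) (simp add: NO_MATCH_def)

text \<open>Tonelli for counting measures. Extending both sums by zero to the whole types removes
  the dependence of the inner range on \<open>i\<close>.\<close>

lemma nn_integral_count_space_Sigma:
  fixes f :: "'i \<Rightarrow> 'j \<Rightarrow> ennreal"
  shows "(\<integral>\<^sup>+ i. (\<integral>\<^sup>+ j. f i j \<partial>count_space (J i)) \<partial>count_space I)
    = (\<integral>\<^sup>+ (i, j). f i j \<partial>count_space (Sigma I J))"
proof -
  have "(\<integral>\<^sup>+ i. (\<integral>\<^sup>+ j. f i j \<partial>count_space (J i)) \<partial>count_space I)
      = (\<integral>\<^sup>+ i. (\<integral>\<^sup>+ j. f i j * indicator (J i) j \<partial>count_space UNIV) * indicator I i \<partial>count_space UNIV)"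
    unfolding nn_integral_count_space_UNIV[of I]
    by (intro nn_integral_cong arg_cong2[where f = "(*)"] nn_integral_count_space_UNIV refl)
  also have "\<dots> = (\<integral>\<^sup>+ i. (\<integral>\<^sup>+ j. f i j * indicator (Sigma I J) (i, j) \<partial>count_space UNIV) \<partial>count_space UNIV)"
    by (intro nn_integral_cong) (simp add: indicator_def)
  also have "\<dots> = (\<integral>\<^sup>+ p. case_prod f p * indicator (Sigma I J) p \<partial>count_space UNIV)"
    using nn_integral_fst_count_space[of "\<lambda>p. case_prod f p * indicator (Sigma I J) p"] by simp
  also have "\<dots> = (\<integral>\<^sup>+ (i, j). f i j \<partial>count_space (Sigma I J))"
    by (rule nn_integral_count_space_UNIV[symmetric])
  finally show ?thesis .
qed

text \<open>Once a listing of every \<open>\<nu> i\<close> is chosen, the double sum becomes a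
  single one over the pairs in \<open>Sigma I J\<close>, which is still countable.\<close>

lemma gen_configs_superpose:
  assumes I: "countable I" and \<nu>: "\<And>i. i \<in> I \<Longrightarrow> \<nu> i \<in> gen_configs M"
  shows "superpose I M \<nu> \<in> gen_configs M"
proof -
  have "\<exists>J y. y \<in> J \<rightarrow> space M \<and> \<nu> i = superpose (J :: nat set) M (\<lambda>j. return M (y j))" if "i \<in> I" for i
    using \<nu>[OF that] by (rule gen_configsE) blast
  then obtain J where "\<And>i. i \<in> I \<Longrightarrow>
      \<exists>y. y \<in> J i \<rightarrow> space M \<and> \<nu> i = superpose (J i :: nat set) M (\<lambda>j. return M (y j))"
    by metis
  then obtain y where J: "\<And>i. i \<in> I \<Longrightarrow> y i \<in> J i \<rightarrow> space M"
    and \<nu>_eq: "\<And>i. i \<in> I \<Longrightarrow> \<nu> i = superpose (J i) M (\<lambda>j. return M (y i j))"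
    by metis
  have "superpose I M \<nu> = superpose (Sigma I J) M (\<lambda>(i, j). return M (y i j))"
  proof (rule measure_eqI)
    fix B assume "B \<in> sets (superpose I M \<nu>)"
    then have B: "B \<in> sets M" by simp
    have "emeasure (superpose I M \<nu>) B
        = (\<integral>\<^sup>+ i. (\<integral>\<^sup>+ j. emeasure (return M (y i j)) B \<partial>count_space (J i)) \<partial>count_space I)"
      using B by (auto simp: emeasure_superpose \<nu>_eq intro!: nn_integral_cong)
    also have "\<dots> = (\<integral>\<^sup>+ (i, j). emeasure (return M (y i j)) B \<partial>count_space (Sigma I J))"
      by (rule nn_integral_count_space_Sigma)
    also have "\<dots> = emeasure (superpose (Sigma I J) M (\<lambda>(i, j). return M (y i j))) B"
      using B by (subst emeasure_superpose) (auto simp: case_prod_unfold)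
    finally show "emeasure (superpose I M \<nu>) B
      = emeasure (superpose (Sigma I J) M (\<lambda>(i, j). return M (y i j))) B" .
  qed simp
  also have "\<dots> \<in> gen_configs M"
    using gen_configs_superpose_return[of "Sigma I J" "\<lambda>(i, j). y i j" M] I J
    by (auto simp: case_prod_unfold Pi_iff)
  finally show ?thesis .
qed

lemma emeasure_superpose_return:
  assumes "B \<in> sets M"
  shows "emeasure (superpose I M (\<lambda>i. return M (y i))) B = emeasure (count_space I) {i \<in> I. y i \<in> B}"
proof -
  have "emeasure (superpose I M (\<lambda>i. return M (y i))) B
      = (\<integral>\<^sup>+ i. indicator {i \<in> I. y i \<in> B} i \<partial>count_space I)"
  proof (subst emeasure_superpose)
    show "(\<integral>\<^sup>+ i. emeasure (return M (y i)) B \<partial>count_space I)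
        = (\<integral>\<^sup>+ i. indicator {i \<in> I. y i \<in> B} i \<partial>count_space I)"
      using assms by (intro nn_integral_cong) (simp add: indicator_def)
  qed (use assms in simp_all)
  also have "\<dots> = emeasure (count_space I) {i \<in> I. y i \<in> B}"
    by (rule nn_integral_indicator) simp
  finally show ?thesis .
qed

text \<open>The value counts the listed points lying in \<open>B\<close>; a nonmeasurable
  \<open>B\<close> falls under the finite case because \<open>emeasure\<close> is 0 there.\<close>

lemma emeasure_gen_configs_cases:
  assumes "\<gamma> \<in> gen_configs M"
  obtains n :: nat where "emeasure \<gamma> B = of_nat n" | "emeasure \<gamma> B = \<infinity>"
proof (cases "B \<in> sets M")
  case True
  from assms obtain I y where "\<gamma> = superpose (I :: nat set) M (\<lambda>i. return M (y i))"
    by (elim gen_configsE)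
  with True that show ?thesis
    by (cases "finite {i \<in> I. y i \<in> B}") (simp_all add: emeasure_superpose_return emeasure_count_space)
next
  case False
  then have "emeasure \<gamma> B = of_nat 0"
    using assms by (simp add: sets_gen_configs emeasure_notin_sets)
  with that show ?thesis by blast
qed

text \<open>Every atom is one of the countably many listed points, and the second components are
  natural numbers.\<close>

lemma countable_config_points:
  assumes "\<gamma> \<in> gen_configs M"
  shows "countable (config_points \<gamma>)"
proof -
  from assms obtain I y where \<gamma>: "\<gamma> = superpose (I :: nat set) M (\<lambda>i. return M (y i))"
    by (elim gen_configsE)
  have "config_points \<gamma> \<subseteq> y ` I \<times> UNIV"
  proof safe
    fix x k assume "(x, k) \<in> config_points \<gamma>"
    then have "emeasure \<gamma> {x} \<noteq> 0"
      by (auto simp: config_points_def)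
    \<comment> \<open>\<open>emeasure\<close> vanishes off the sigma-algebra, so a singleton of
      positive mass is measurable.\<close>
    moreover from this have "{x} \<in> sets M"
      using \<gamma> emeasure_notin_sets[of "{x}" \<gamma>] by auto
    ultimately have "emeasure (count_space I) {i \<in> I. y i = x} \<noteq> 0"
      using \<gamma> by (simp add: emeasure_superpose_return)
    then have "{i \<in> I. y i = x} \<noteq> {}"
      by (metis emeasure_empty)
    then show "x \<in> y ` I" by auto
  qed auto
  then show ?thesis
    by (rule countable_subset) auto
qed

text \<open>This turns sums over \<open>config_points\<close> into integrals against \<gamma>, which
  are free of any listing of the points. Both sides are compared with the sum of
  \<open>f (y i)\<close> over a listing \<open>y\<close>: the number of \<open>k\<close> paired with
  \<open>x\<close> and the number of \<open>i\<close> with \<open>y i = x\<close> are the same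
  multiplicity.\<close>

lemma nn_integral_config_points:
  assumes \<gamma>: "\<gamma> \<in> gen_configs M" and sing: "\<And>x. x \<in> space M \<Longrightarrow> {x} \<in> sets M"
    and f: "f \<in> borel_measurable M"
  shows "(\<integral>\<^sup>+ (x, k). f x \<partial>count_space (config_points \<gamma>)) = (\<integral>\<^sup>+ x. f x \<partial>\<gamma>)"
proof -
  from \<gamma> obtain I y where y: "y \<in> I \<rightarrow> space M"
    and \<gamma>_eq: "\<gamma> = superpose (I :: nat set) M (\<lambda>i. return M (y i))"
    by (elim gen_configsE)
  have mult: "emeasure \<gamma> {x} = emeasure (count_space I) {i \<in> I. y i = x}" for x
  proof (cases "x \<in> space M")
    case True
    then show ?thesis using sing by (simp add: \<gamma>_eq emeasure_superpose_return)
  next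
    \<comment> \<open>Off the space, \<open>{x}\<close> is not measurable and no index maps to
      \<open>x\<close>, so both sides are 0.\<close>
    case False
    then have "{x} \<notin> sets \<gamma>" "{i \<in> I. y i = x} = {}"
      using sets.sets_into_space[of "{x}" \<gamma>] y \<gamma>_eq by auto
    then show ?thesis by (metis emeasure_notin_sets emeasure_empty)
  qed
  have points: "emeasure \<gamma> {x} = (\<integral>\<^sup>+ k. indicator (config_points \<gamma>) (x, k) \<partial>count_space UNIV)" for x
  proof -
    have "(\<integral>\<^sup>+ k. indicator (config_points \<gamma>) (x, k) \<partial>count_space UNIV)
        = emeasure (count_space UNIV) {k. (of_nat k :: ennreal) < emeasure \<gamma> {x}}"
      by (auto simp: config_points_def simp flip: nn_integral_indicator
          split: split_indicator intro!: nn_integral_cong)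
    \<comment> \<open>There are exactly m natural numbers below a multiplicity m, be it finite or
      \<infinity>.\<close>
    also have "\<dots> = emeasure \<gamma> {x}"
      by (rule emeasure_gen_configs_cases[OF \<gamma>, of "{x}"])
        (auto simp: of_nat_less_top ennreal_of_nat_eq_real_of_nat ennreal_less_iff simp flip: lessThan_def)
    finally show ?thesis ..
  qed
  have "(\<integral>\<^sup>+ (x, k). f x \<partial>count_space (config_points \<gamma>))
      = (\<integral>\<^sup>+ (x, k). f x * indicator (config_points \<gamma>) (x, k) \<partial>count_space UNIV)"
    by (subst nn_integral_count_space_UNIV) (simp add: case_prod_unfold)
  also have "\<dots> = (\<integral>\<^sup>+ x. (\<integral>\<^sup>+ k. f x * indicator (config_points \<gamma>) (x, k) \<partial>count_space UNIV) \<partial>count_space UNIV)"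
    by (subst nn_integral_fst_count_space[symmetric]) simp
  also have "\<dots> = (\<integral>\<^sup>+ x. f x * emeasure \<gamma> {x} \<partial>count_space UNIV)"
    by (simp add: nn_integral_cmult points)
  also have "\<dots> = (\<integral>\<^sup>+ x. (\<integral>\<^sup>+ i. f x * indicator {i \<in> I. y i = x} i \<partial>count_space UNIV) \<partial>count_space UNIV)"
  proof -
    have "emeasure (count_space I) {i \<in> I. y i = x} = (\<integral>\<^sup>+ i. indicator {i \<in> I. y i = x} i \<partial>count_space UNIV)" for x
      by (auto simp: emeasure_count_space)
    then show ?thesis
      by (simp add: mult nn_integral_cmult)
  qed
  \<comment> \<open>Exchanging the sums lets the inner one collapse: for fixed \<open>i\<close> only
    \<open>x = y i\<close> contributes.\<close>
  also have "\<dots> = (\<integral>\<^sup>+ i. (\<integral>\<^sup>+ x. f x * indicator {i \<in> I. y i = x} i \<partial>count_space UNIV) \<partial>count_space UNIV)"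
    using nn_integral_fst_count_space[of "\<lambda>(x, i). f x * indicator {i \<in> I. y i = x} i"]
      nn_integral_snd_count_space[of "\<lambda>(x, i). f x * indicator {i \<in> I. y i = x} i"] by simp
  also have "\<dots> = (\<integral>\<^sup>+ i. f (y i) * indicator I i \<partial>count_space UNIV)"
  proof (rule nn_integral_cong)
    fix i
    have "(\<integral>\<^sup>+ x. f x * indicator {i \<in> I. y i = x} i \<partial>count_space UNIV)
        = (\<integral>\<^sup>+ x. (f x * indicator I i) * indicator {y i} x \<partial>count_space UNIV)"
      by (intro nn_integral_cong) (simp add: indicator_def)
    also have "\<dots> = f (y i) * indicator I i"
      by (subst nn_integral_indicator_singleton) simp_all
    finally show "(\<integral>\<^sup>+ x. f x * indicator {i \<in> I. y i = x} i \<partial>count_space UNIV) = f (y i) * indicator I i" .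
  qed
  also have "\<dots> = (\<integral>\<^sup>+ i. f (y i) \<partial>count_space I)"
    by (rule nn_integral_count_space_UNIV[symmetric])
  also have "\<dots> = (\<integral>\<^sup>+ x. f x \<partial>\<gamma>)"
    unfolding \<gamma>_eq using f y
    by (subst nn_integral_superpose) (auto intro!: nn_integral_cong nn_integral_return[symmetric])
  finally show ?thesis .
qed

section \<open>The sigma-algebra on configurations and its measurable functionals\<close>

lemma space_config_space [simp]: "space (config_space M) = gen_configs M"
  by (auto simp: config_space_def intro!: space_measure_of)

lemma sets_config_space:
  "sets (config_space M) = sigma_sets (gen_configs M)
    {{\<gamma> \<in> gen_configs M. emeasure \<gamma> B = of_nat n} | B (n :: nat). B \<in> sets M}"
  unfolding config_space_def by (rule sets_measure_of) auto

text \<open>The generators fix only finite counts; the event of count \<infinity> is the complement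
  of their countable union. As there are countably many values, it suffices to check single
  ones.\<close>

lemma measurable_emeasure_config_space [measurable]:
  "(\<lambda>\<gamma>. emeasure \<gamma> B) \<in> borel_measurable (config_space M)"
proof (cases "B \<in> sets M")
  case True
  let ?V = "range of_nat \<union> {\<infinity> :: ennreal}"
  have "(\<lambda>\<gamma>. emeasure \<gamma> B) \<in> measurable (config_space M) (count_space ?V)"
  proof (subst measurable_count_space_eq_countable)
    have fin: "{\<gamma> \<in> gen_configs M. emeasure \<gamma> B = of_nat n} \<in> sets (config_space M)" for n :: nat
      unfolding sets_config_space using True by (intro sigma_sets.Basic) blast
    have "(\<lambda>\<gamma>. emeasure \<gamma> B) -` {v} \<inter> space (config_space M) \<in> sets (config_space M)" if "v \<in> ?V" for v
    proof (cases "v = \<infinity>")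
      case True
      have "(\<lambda>\<gamma>. emeasure \<gamma> B) -` {v} \<inter> space (config_space M)
          = space (config_space M) - (\<Union>n::nat. {\<gamma> \<in> gen_configs M. emeasure \<gamma> B = of_nat n})"
        using True by (auto simp: ennreal_of_nat_eq_real_of_nat)
          (metis emeasure_gen_configs_cases ennreal_of_nat_eq_real_of_nat infinity_ennreal_def)
      moreover have "\<dots> \<in> sets (config_space M)"
        using fin sets.top[of "config_space M"] by (intro sets.Diff sets.countable_UN) auto
      ultimately show ?thesis by simp
    next
      case False
      with that obtain n where "v = of_nat n" by auto
      then have "(\<lambda>\<gamma>. emeasure \<gamma> B) -` {v} \<inter> space (config_space M)
          = {\<gamma> \<in> gen_configs M. emeasure \<gamma> B = of_nat n}" by auto
      then show ?thesis using fin by simp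
    qed
    moreover have "emeasure \<gamma> B \<in> ?V" if "\<gamma> \<in> gen_configs M" for \<gamma>
      using that by (auto elim: emeasure_gen_configs_cases[where B = B])
    ultimately show "(\<lambda>\<gamma>. emeasure \<gamma> B) \<in> space (config_space M) \<rightarrow> ?V \<and>
      (\<forall>v\<in>?V. (\<lambda>\<gamma>. emeasure \<gamma> B) -` {v} \<inter> space (config_space M) \<in> sets (config_space M))"
      by auto
  qed auto
  \<comment> \<open>Composing with \<open>id\<close> passes from the discrete space on the values to
    the Borel space.\<close>
  then have "(\<lambda>\<gamma>. id (emeasure \<gamma> B)) \<in> borel_measurable (config_space M)"
    by (rule measurable_compose) simp
  then show ?thesis by simp
next
  case False
  then have "emeasure \<gamma> B = 0" if "\<gamma> \<in> gen_configs M" for \<gamma>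
    using that by (simp add: sets_gen_configs emeasure_notin_sets)
  then show ?thesis
    by (subst measurable_cong[where g = "\<lambda>_. 0"]) auto
qed

lemma measurable_config_spaceI:
  assumes "f \<in> space S \<rightarrow> gen_configs M"
    and [measurable]: "\<And>B. B \<in> sets M \<Longrightarrow> (\<lambda>s. emeasure (f s) B) \<in> borel_measurable S"
  shows "f \<in> measurable S (config_space M)"
  unfolding config_space_def
proof (rule measurable_measure_of)
  fix A assume "A \<in> {{\<gamma> \<in> gen_configs M. emeasure \<gamma> B = of_nat n} | B (n :: nat). B \<in> sets M}"
  then obtain B and n :: nat
    where A: "A = {\<gamma> \<in> gen_configs M. emeasure \<gamma> B = of_nat n}" and [measurable]: "B \<in> sets M"
    by blast
  have "f -` A \<inter> space S = {s \<in> space S. emeasure (f s) B = of_nat n}"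
    using assms(1) by (auto simp: A)
  then show "f -` A \<inter> space S \<in> sets S" by simp
qed (use assms in auto)

lemma measurable_nn_integral_config_space:
  assumes "f \<in> borel_measurable M"
  shows "(\<lambda>\<gamma>. \<integral>\<^sup>+ x. f x \<partial>\<gamma>) \<in> borel_measurable (config_space M)"
  using assms
proof (induction rule: borel_measurable_induct)
  case (cong f g)
  have "(\<lambda>\<gamma>. integral\<^sup>N \<gamma> f) \<in> borel_measurable (config_space M) \<longleftrightarrow>
    (\<lambda>\<gamma>. integral\<^sup>N \<gamma> g) \<in> borel_measurable (config_space M)"
    using cong(3) by (intro measurable_cong nn_integral_cong)
      (auto simp: sets_eq_imp_space_eq[OF sets_gen_configs])
  with cong show ?case by simp
next
  case (set A)
  then show ?case
    by (subst measurable_cong[where g = "\<lambda>\<gamma>. emeasure \<gamma> A"]) (auto simp: sets_gen_configs)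
next
  case (mult u c)
  then show ?case
    by (subst measurable_cong[where g = "\<lambda>\<gamma>. c * integral\<^sup>N \<gamma> u"])
      (auto simp: nn_integral_cmult measurable_cong_sets[OF sets_gen_configs refl])
next
  case (add u v)
  then show ?case
    by (subst measurable_cong[where g = "\<lambda>\<gamma>. integral\<^sup>N \<gamma> v + integral\<^sup>N \<gamma> u"])
      (auto simp: nn_integral_add measurable_cong_sets[OF sets_gen_configs refl])
next
  case (seq U)
  have "integral\<^sup>N \<gamma> (\<Squnion> range U) = (SUP n. integral\<^sup>N \<gamma> (U n))" if "\<gamma> \<in> gen_configs M" for \<gamma>
    using seq that unfolding SUP_apply
    by (intro nn_integral_monotone_convergence_SUP) (auto simp: measurable_cong_sets[OF sets_gen_configs refl])
  with seq show ?case
    by (subst measurable_cong[where g = "\<lambda>\<gamma>. SUP n. integral\<^sup>N \<gamma> (U n)"]) auto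
qed


section \<open>Laplace transforms of independent sums\<close>

text \<open>The value at \<infinity> is set apart because \<open>enn2real\<close> maps \<infinity>
  to 0, which would give 1. Real values allow the subtractions by which coefficients of generating
  functions are extracted.\<close>

definition exp_neg :: "ennreal \<Rightarrow> real" where
  "exp_neg t = (if t = \<infinity> then 0 else exp (- enn2real t))"

text \<open>The inverse of \<open>exp_neg\<close> on [0, 1], the range of Laplace transforms of
  probability measures.\<close>

definition neg_ln :: "ennreal \<Rightarrow> ennreal" where
  "neg_ln p = (if p = 0 then \<infinity> else ennreal (- ln (enn2real p)))"

lemma exp_neg_nonneg [simp]: "0 \<le> exp_neg t"
  and exp_neg_le_1 [simp]: "exp_neg t \<le> 1"
  by (simp_all add: exp_neg_def)

lemma exp_neg_0 [simp]: "exp_neg 0 = 1"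
  and exp_neg_top [simp]: "exp_neg \<top> = 0"
  by (simp_all add: exp_neg_def)

lemma exp_neg_ennreal: "0 \<le> r \<Longrightarrow> exp_neg (ennreal r) = exp (- r)"
  by (simp add: exp_neg_def)

lemma exp_neg_add: "exp_neg (s + t) = exp_neg s * exp_neg t"
  by (cases s; cases t) (auto simp: exp_neg_ennreal exp_diff exp_minus field_simps simp flip: ennreal_plus)

lemma exp_neg_sum: "exp_neg (\<Sum>i\<in>I. f i) = (\<Prod>i\<in>I. exp_neg (f i))"
  by (induction I rule: infinite_finite_induct) (simp_all add: exp_neg_add)

lemma measurable_exp_neg [measurable]: "exp_neg \<in> borel_measurable borel"
  unfolding exp_neg_def by measurable

lemma measurable_neg_ln [measurable]: "neg_ln \<in> borel_measurable borel"
  unfolding neg_ln_def by measurable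

text \<open>The two maps are decreasing and, on [0, 1], inverse to each other. The bound on
  \<open>p\<close> keeps \<open>- ln p\<close> nonnegative; beyond 1 the equivalence breaks at
  \<open>t = 0\<close>.\<close>

lemma le_exp_neg_iff:
  assumes "p \<le> 1"
  shows "p \<le> ennreal (exp_neg t) \<longleftrightarrow> t \<le> neg_ln p"
proof (cases "p = 0 \<or> t = \<infinity>")
  case True
  then show ?thesis
    by (auto simp: neg_ln_def top_unique)
next
  case False
  with assms obtain q where q: "p = ennreal q" "0 < q" "q \<le> 1"
    by (cases p) (auto simp: less_le top_unique)
  from False obtain r where r: "t = ennreal r" "0 \<le> r"
    by (cases t) auto
  have "q \<le> exp (- r) \<longleftrightarrow> r \<le> - ln q"
    using q ln_ge_iff[of q "- r"] by (metis exp_ge_zero exp_ln ln_exp ln_le_cancel_iff exp_gt_zero le_minus_iff)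
  with q r show ?thesis
    by (simp add: exp_neg_ennreal neg_ln_def)
qed

lemma exp_neg_neg_ln: "p \<le> 1 \<Longrightarrow> ennreal (exp_neg (neg_ln p)) = p"
proof (cases "p = 0")
  case False
  assume "p \<le> 1"
  with False obtain q where q: "p = ennreal q" "0 < q" "q \<le> 1"
    by (cases p) (auto simp: less_le top_unique)
  then show ?thesis
    by (simp add: neg_ln_def exp_neg_ennreal)
qed (simp add: neg_ln_def)

lemma exp_neg_antimono: "s \<le> t \<Longrightarrow> exp_neg t \<le> exp_neg s"
proof -
  assume "s \<le> t"
  also have "t \<le> neg_ln (ennreal (exp_neg t))"
    by (subst le_exp_neg_iff[symmetric]) (simp_all flip: ennreal_1)
  finally have "ennreal (exp_neg t) \<le> ennreal (exp_neg s)"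
    by (subst le_exp_neg_iff) (simp_all flip: ennreal_1)
  then show ?thesis by simp
qed

text \<open>By \<open>le_exp_neg_iff\<close>, the maps form an antitone Galois connection, so suprema become infima.\<close>

lemma exp_neg_SUP:
  assumes "I \<noteq> {}"
  shows "ennreal (exp_neg (SUP i\<in>I. f i)) = (INF i\<in>I. ennreal (exp_neg (f i)))"
proof (rule antisym)
  let ?p = "INF i\<in>I. ennreal (exp_neg (f i))"
  have "?p \<le> 1"
    using assms by (metis INF_lower2 all_not_in_conv ennreal_1 ennreal_leI exp_neg_le_1)
  moreover have "f i \<le> neg_ln ?p" if "i \<in> I" for i
    using that \<open>?p \<le> 1\<close> by (subst le_exp_neg_iff[symmetric]) (auto intro: INF_lower)
  ultimately show "?p \<le> ennreal (exp_neg (SUP i\<in>I. f i))"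
    by (subst le_exp_neg_iff) (auto intro: SUP_least)
qed (auto intro!: INF_greatest ennreal_leI exp_neg_antimono SUP_upper)

text \<open>Independence turns the exponential of a sum into a product of integrals. Writing each
  factor as \<open>exp_neg\<close> of its \<open>neg_ln\<close> makes the right side an exponential
  of a sum again, the form in which the index set can grow to a countable one.\<close>

lemma (in product_prob_space) nn_integral_exp_neg_PiM_finite:
  assumes J: "finite J" "J \<subseteq> I"
    and h [measurable]: "\<And>i. i \<in> I \<Longrightarrow> h i \<in> borel_measurable (M i)"
  shows "(\<integral>\<^sup>+ \<omega>. ennreal (exp_neg (\<Sum>i\<in>J. h i (\<omega> i))) \<partial>PiM I M)
    = ennreal (exp_neg (\<Sum>i\<in>J. neg_ln (\<integral>\<^sup>+ y. ennreal (exp_neg (h i y)) \<partial>M i)))"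
proof -
  have [measurable]: "h i \<in> borel_measurable (M i)" if "i \<in> J" for i
    using h J that by auto
  have "(\<integral>\<^sup>+ \<omega>. ennreal (exp_neg (\<Sum>i\<in>J. h i (\<omega> i))) \<partial>PiM I M)
      = (\<integral>\<^sup>+ \<omega>. (\<Prod>i\<in>J. ennreal (exp_neg (h i (restrict \<omega> J i)))) \<partial>PiM I M)"
    by (intro nn_integral_cong) (simp add: exp_neg_sum prod_ennreal)
  \<comment> \<open>The integrand sees only the coordinates in \<open>J\<close>, so it may be
    integrated against the finite marginal.\<close>
  also have "\<dots> = (\<integral>\<^sup>+ \<omega>. (\<Prod>i\<in>J. ennreal (exp_neg (h i (\<omega> i)))) \<partial>PiM J M)"
  proof -
    have "(\<lambda>\<omega>. \<Prod>i\<in>J. ennreal (exp_neg (h i (\<omega> i)))) \<in> borel_measurable (PiM J M)"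
      by measurable
    then show ?thesis
      using nn_integral_distr[OF measurable_restrict_subset[OF J(2)],
          of "\<lambda>\<omega>. \<Prod>i\<in>J. ennreal (exp_neg (h i (\<omega> i)))" M]
      by (simp add: distr_PiM_restrict_finite[OF J])
  qed
  also have "\<dots> = (\<Prod>i\<in>J. \<integral>\<^sup>+ y. ennreal (exp_neg (h i y)) \<partial>M i)"
    using J by (intro product_nn_integral_prod) auto
  also have "\<dots> = (\<Prod>i\<in>J. ennreal (exp_neg (neg_ln (\<integral>\<^sup>+ y. ennreal (exp_neg (h i y)) \<partial>M i))))"
  proof (intro prod.cong refl exp_neg_neg_ln[symmetric])
    fix i
    have "(\<integral>\<^sup>+ y. ennreal (exp_neg (h i y)) \<partial>M i) \<le> (\<integral>\<^sup>+ y. 1 \<partial>M i)"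
      by (intro nn_integral_mono) (simp flip: ennreal_1)
    then show "(\<integral>\<^sup>+ y. ennreal (exp_neg (h i y)) \<partial>M i) \<le> 1"
      by (simp add: M.emeasure_space_1)
  qed
  finally show ?thesis
    by (simp add: exp_neg_sum prod_ennreal)
qed

lemma finite_to_nat_on_less:
  assumes "countable I"
  shows "finite {i \<in> I. to_nat_on I i < n}"
proof (rule finite_subset)
  show "{i \<in> I. to_nat_on I i < n} \<subseteq> from_nat_into I ` {..<n}"
    using assms by (auto simp: image_iff Bex_def intro!: exI[of _ "to_nat_on I _"])
qed simp

text \<open>The finite sets of indices numbered below \<open>n\<close> increase to \<open>I\<close>,
  so monotone convergence applies. A supremum along a sequence keeps measurability and can be moved
  through integrals.\<close>

lemma nn_integral_count_space_SUP:
  fixes f :: "'i \<Rightarrow> ennreal"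
  assumes "countable I"
  shows "(\<integral>\<^sup>+ i. f i \<partial>count_space I) = (SUP n::nat. \<Sum>i | i \<in> I \<and> to_nat_on I i < n. f i)"
proof -
  let ?J = "\<lambda>n. {i \<in> I. to_nat_on I i < n}"
  have fin: "finite (?J n)" for n
    using assms by (rule finite_to_nat_on_less)
  have "(\<integral>\<^sup>+ i. f i \<partial>count_space I) = (\<integral>\<^sup>+ i. (SUP n. f i * indicator (?J n) i) \<partial>count_space I)"
  proof (rule nn_integral_cong)
    fix i assume "i \<in> space (count_space I)"
    \<comment> \<open>Index \<open>i\<close> enters the exhaustion at stage
      \<open>Suc (to_nat_on I i)\<close>, because the bound is strict.\<close>
    then have "f i * indicator (?J (Suc (to_nat_on I i))) i = f i" by simp
    then show "f i = (SUP n. f i * indicator (?J n) i)"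
      by (intro antisym SUP_least) (auto intro: SUP_upper2[of "Suc (to_nat_on I i)"] split: split_indicator)
  qed
  also have "\<dots> = (SUP n. \<integral>\<^sup>+ i. f i * indicator (?J n) i \<partial>count_space I)"
    by (intro nn_integral_monotone_convergence_SUP)
      (auto simp: incseq_def le_fun_def split: split_indicator)
  also have "\<dots> = (SUP n. \<Sum>i\<in>?J n. f i)"
  proof (rule SUP_cong[OF refl])
    fix n
    have "(\<integral>\<^sup>+ i. f i * indicator (?J n) i \<partial>count_space I) = (\<Sum>i\<in>?J n. f i * indicator (?J n) i)"
      using fin by (intro nn_integral_count_space') auto
    then show "(\<integral>\<^sup>+ i. f i * indicator (?J n) i \<partial>count_space I) = (\<Sum>i\<in>?J n. f i)"
      by simp
  qed
  finally show ?thesis .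
qed

text \<open>Limit of the finite case along the exhaustion: growing sums become decreasing
  exponentials, and the infimum passes through the integral.\<close>

lemma (in product_prob_space) nn_integral_exp_neg_PiM:
  assumes I: "countable I"
    and h [measurable]: "\<And>i. i \<in> I \<Longrightarrow> h i \<in> borel_measurable (M i)"
  shows "(\<integral>\<^sup>+ \<omega>. ennreal (exp_neg (\<integral>\<^sup>+ i. h i (\<omega> i) \<partial>count_space I)) \<partial>PiM I M)
    = ennreal (exp_neg (\<integral>\<^sup>+ i. neg_ln (\<integral>\<^sup>+ y. ennreal (exp_neg (h i y)) \<partial>M i) \<partial>count_space I))"
proof -
  let ?J = "\<lambda>n. {i \<in> I. to_nat_on I i < n}"
  have fin: "finite (?J n)" for n
    using I by (rule finite_to_nat_on_less)
  let ?g = "\<lambda>n \<omega>. ennreal (exp_neg (\<Sum>i\<in>?J n. h i (\<omega> i)))"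
  have meas: "?g n \<in> borel_measurable (PiM I M)" for n
  proof -
    have [measurable]: "h i \<in> borel_measurable (M i)" if "i \<in> ?J n" for i
      using that by simp
    show ?thesis by measurable
  qed
  have "(\<integral>\<^sup>+ \<omega>. ennreal (exp_neg (\<integral>\<^sup>+ i. h i (\<omega> i) \<partial>count_space I)) \<partial>PiM I M)
      = (\<integral>\<^sup>+ \<omega>. (INF n. ?g n \<omega>) \<partial>PiM I M)"
    using I by (simp add: nn_integral_count_space_SUP exp_neg_SUP)
  also have "\<dots> = (INF n. \<integral>\<^sup>+ \<omega>. ?g n \<omega> \<partial>PiM I M)"
  proof (rule nn_integral_monotone_convergence_INF_decseq)
    show "decseq ?g"
      using fin
      by (intro antimonoI le_funI ennreal_leI exp_neg_antimono sum_mono2) auto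
    \<comment> \<open>Decreasing convergence needs a member with finite integral; the integrands are
      at most 1 under a probability measure.\<close>
    have "(\<integral>\<^sup>+ \<omega>. ?g 0 \<omega> \<partial>PiM I M) \<le> (\<integral>\<^sup>+ \<omega>. 1 \<partial>PiM I M)"
      by (intro nn_integral_mono) (simp flip: ennreal_1)
    also have "\<dots> < \<infinity>"
      by (simp add: P.emeasure_space_1)
    finally show "(\<integral>\<^sup>+ \<omega>. ?g 0 \<omega> \<partial>PiM I M) < \<infinity>" .
  qed (rule meas)
  also have "\<dots> = (INF n. ennreal (exp_neg (\<Sum>i\<in>?J n. neg_ln (\<integral>\<^sup>+ y. ennreal (exp_neg (h i y)) \<partial>M i))))"
    using fin by (intro INF_cong refl nn_integral_exp_neg_PiM_finite) auto
  finally show ?thesis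
    using I by (simp add: nn_integral_count_space_SUP exp_neg_SUP)
qed


section \<open>Measurability of kernels through Laplace functionals\<close>

text \<open>The probabilities of \<open>N = n\<close> are the Taylor coefficients at \<open>0\<close> of the generating function
  \<open>z \<mapsto> \<integral> R z\<^sup>N\<close>.  They are peeled off one at a time, as limits along \<open>z = 1 / (m + 2)\<close>.\<close>

lemma borel_measurable_integral_indicator_eq_of_nat:
  fixes N :: "'b \<Rightarrow> ennreal"
  assumes K: "\<And>s. s \<in> space S \<Longrightarrow> prob_space (K s)" "\<And>s. s \<in> space S \<Longrightarrow> sets (K s) = sets T"
    and N [measurable]: "N \<in> borel_measurable T"
    and N_cases: "\<And>w. w \<in> space T \<Longrightarrow> N w = \<infinity> \<or> (\<exists>k. N w = of_nat k)"
    and R [measurable]: "R \<in> borel_measurable T"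
    and R_bounds: "\<And>w. w \<in> space T \<Longrightarrow> 0 \<le> R w \<and> R w \<le> (1 :: real)"
    and laplace: "\<And>t. 0 < t \<Longrightarrow> (\<lambda>s. \<integral>w. R w * exp_neg (ennreal t * N w) \<partial>K s) \<in> borel_measurable S"
  shows "(\<lambda>s. \<integral>w. R w * indicator {w. N w = of_nat n} w \<partial>K s) \<in> borel_measurable S"
proof (induction n rule: less_induct)
  case (less n)
  define I where "I j s = (\<integral>w. R w * indicator {w. N w = of_nat j} w \<partial>K s)" for j s
  \<comment> \<open>\<open>c m\<close> is 1 / z. The offset 2 makes \<open>t = ln (c m)\<close>
    positive, so that \<open>laplace\<close> applies, and z^N is
    \<open>exp_neg (t * N)\<close>.\<close>
  define c where "c m = real (m + 2)" for m
  \<comment> \<open>Subtracting the known coefficients below \<open>n\<close> and dividing by z^n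
    leaves the coefficient of order \<open>n\<close> in the limit; \<open>u\<close> is the same
    operation under the integral.\<close>
  define F where "F m s = c m ^ n * ((\<integral>w. R w * exp_neg (ennreal (ln (c m)) * N w) \<partial>K s)
    - (\<Sum>j<n. I j s / c m ^ j))" for m s
  define u where "u m w = c m ^ n * (exp_neg (ennreal (ln (c m)) * N w)
    - (\<Sum>j<n. indicator {w. N w = of_nat j} w / c m ^ j))" for m w
  have c: "2 \<le> c m" for m by (simp add: c_def)
  \<comment> \<open>For \<open>k < n\<close> the subtracted sum cancels the power; otherwise z^(k -
    n) remains, which is 1 for \<open>k = n\<close> and tends to 0 for \<open>k > n\<close>.\<close>
  have u_nat: "u m w = (if k < n then 0 else 1 / c m ^ (k - n))" if "N w = of_nat k" for m w k
  proof -
    have "exp_neg (ennreal (ln (c m)) * N w) = exp (- (ln (c m) * real k))"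
      using c[of m] that
      by (simp add: ennreal_of_nat_eq_real_of_nat exp_neg_ennreal flip: ennreal_mult')
    also have "\<dots> = 1 / c m ^ k"
      using c[of m] by (simp add: exp_minus mult.commute exp_of_nat_mult field_simps)
    finally have *: "exp_neg (ennreal (ln (c m)) * N w) = 1 / c m ^ k" .
    have "(\<Sum>j<n. indicator {w. N w = of_nat j} w / c m ^ j) = (\<Sum>j<n. if j = k then 1 / c m ^ k else 0)"
      using that by (intro sum.cong refl) (auto simp: ennreal_of_nat_eq_real_of_nat)
    then show ?thesis
      using c[of m] by (auto simp: u_def * power_diff)
  qed
  \<comment> \<open>Here z^N is 0 and no indicator is hit, so points with infinite count contribute
    nothing.\<close>
  have u_inf: "u m w = 0" if "N w = \<infinity>" for m w
  proof -
    have "exp_neg (ennreal (ln (c m)) * N w) = 0"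
      using c[of m] that by (simp add: ennreal_mult_top)
    moreover have "indicator {w. N w = of_nat j} w = (0 :: real)" for j
      using that by (simp add: ennreal_of_nat_eq_real_of_nat)
    ultimately show ?thesis by (simp add: u_def)
  qed
  have u_bounds: "0 \<le> u m w \<and> u m w \<le> 1" if "w \<in> space T" for m w
    using N_cases[OF that]
  proof
    assume "\<exists>k. N w = of_nat k"
    then obtain k where "N w = of_nat k" ..
    moreover have "1 \<le> c m ^ (k - n)"
      using c[of m] by (intro one_le_power) simp
    ultimately show ?thesis by (simp add: u_nat)
  qed (simp add: u_inf)
  have u_lim: "(\<lambda>m. u m w) \<longlonglongrightarrow> indicator {w. N w = of_nat n} w" if "w \<in> space T" for w
    using N_cases[OF that]
  proof
    assume "\<exists>k. N w = of_nat k"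
    then obtain k where k: "N w = of_nat k" ..
    show ?thesis
    proof (cases "n < k")
      case True
      have "(\<lambda>m. inverse (c m)) \<longlonglongrightarrow> 0"
        unfolding c_def by (rule LIMSEQ_ignore_initial_segment[OF lim_inverse_n])
      then have "(\<lambda>m. inverse (c m) ^ (k - n)) \<longlonglongrightarrow> 0 ^ (k - n)"
        by (rule tendsto_power)
      with True show ?thesis
        by (simp add: u_nat[OF k] k ennreal_of_nat_eq_real_of_nat power_inverse inverse_eq_divide power_one_over zero_power)
    next
      case False
      then show ?thesis
        by (cases "k = n") (simp_all add: u_nat[OF k] k indicator_def ennreal_of_nat_eq_real_of_nat)
    qed
  qed (simp add: u_inf ennreal_of_nat_eq_real_of_nat)
  have F_eq: "F m s = (\<integral>w. R w * u m w \<partial>K s)" if s: "s \<in> space S" for m s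
  proof -
    interpret prob_space "K s" using K(1)[OF s] .
    note [measurable_cong] = K(2)[OF s]
    have space: "space (K s) = space T" by (rule sets_eq_imp_space_eq) (rule K(2)[OF s])
    have int: "integrable (K s) (\<lambda>w. R w * v w)"
      if [measurable]: "v \<in> borel_measurable T" and v: "\<And>w. 0 \<le> v w \<and> v w \<le> (1 :: real)" for v
      using R_bounds v by (intro integrable_const_bound[where B = 1]) (auto simp: space mult_le_one)
    have int1: "integrable (K s) (\<lambda>w. R w * exp_neg (ennreal (ln (c m)) * N w))"
      by (intro int) auto
    have int2: "integrable (K s) (\<lambda>w. R w * indicator {w. N w = of_nat j} w)" for j
    proof -
      have "integrable (K s) (\<lambda>w. R w * of_bool (N w = of_nat j))"
        by (intro int) auto
      moreover have "(\<lambda>w. R w * of_bool (N w = of_nat j)) = (\<lambda>w. R w * indicator {w. N w = of_nat j} w)"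
        by (auto simp: fun_eq_iff)
      ultimately show ?thesis by simp
    qed
    have "F m s = c m ^ n * ((\<integral>w. R w * exp_neg (ennreal (ln (c m)) * N w) \<partial>K s)
        - (\<integral>w. (\<Sum>j<n. R w * indicator {w. N w = of_nat j} w / c m ^ j) \<partial>K s))"
      unfolding F_def I_def using int2 by (subst Bochner_Integration.integral_sum) auto
    also have "\<dots> = (\<integral>w. c m ^ n * (R w * exp_neg (ennreal (ln (c m)) * N w)
        - (\<Sum>j<n. R w * indicator {w. N w = of_nat j} w / c m ^ j)) \<partial>K s)"
      using int1 int2 by (subst Bochner_Integration.integral_diff[symmetric]) auto
    also have "\<dots> = (\<integral>w. R w * u m w \<partial>K s)"
      by (intro Bochner_Integration.integral_cong refl)
        (simp add: u_def algebra_simps sum_distrib_left)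
    finally show ?thesis .
  qed
  have "(\<lambda>m. F m s) \<longlonglongrightarrow> I n s" if s: "s \<in> space S" for s
  proof -
    interpret prob_space "K s" using K(1)[OF s] .
    note [measurable_cong] = K(2)[OF s]
    have space: "space (K s) = space T" by (rule sets_eq_imp_space_eq) (rule K(2)[OF s])
    have "(\<lambda>m. \<integral>w. R w * u m w \<partial>K s) \<longlonglongrightarrow> (\<integral>w. R w * indicator {w. N w = of_nat n} w \<partial>K s)"
    \<comment> \<open>The bounds on \<open>R\<close> and \<open>u\<close> give the dominating
      constant 1, integrable under a probability measure.\<close>
    proof (rule integral_dominated_convergence[where w = "\<lambda>_. 1"])
      have [measurable]: "indicator {w. N w = of_nat j} \<in> borel_measurable T" for j
        by measurable
      then show "(\<lambda>w. R w * indicator {w. N w = of_nat n} w) \<in> borel_measurable (K s)"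
        by simp
      show "(\<lambda>w. R w * u m w) \<in> borel_measurable (K s)" for m
        unfolding u_def by simp
      show "AE w in K s. (\<lambda>m. R w * u m w) \<longlonglongrightarrow> R w * indicator {w. N w = of_nat n} w"
        by (auto simp: space intro!: tendsto_mult u_lim)
      show "AE w in K s. norm (R w * u m w) \<le> 1" for m
        using R_bounds u_bounds by (auto simp: space mult_le_one abs_mult)
    qed simp
    then show ?thesis
      by (simp add: I_def F_eq[OF s])
  qed
  moreover have "F m \<in> borel_measurable S" for m
  proof -
    have [measurable]: "I j \<in> borel_measurable S" if "j \<in> {..<n}" for j
      using less[of j] that by (simp add: I_def[abs_def])
    have [measurable]: "(\<lambda>s. \<integral>w. R w * exp_neg (ennreal (ln (c m)) * N w) \<partial>K s) \<in> borel_measurable S"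
      using c[of m] by (intro laplace) simp
    have "(\<lambda>s. \<Sum>j<n. I j s / c m ^ j) \<in> borel_measurable S"
      by (rule borel_measurable_sum) measurable
    then show ?thesis
      unfolding F_def by measurable
  qed
  ultimately have "I n \<in> borel_measurable S"
    by (rule borel_measurable_LIMSEQ_real)
  then show ?case
    by (simp add: I_def[abs_def])
qed

lemma sets_config_space_finite_constraints:
  assumes "finite F" "F \<subseteq> sets M \<times> UNIV"
  shows "{\<gamma> \<in> gen_configs M. \<forall>(B, n)\<in>F. emeasure \<gamma> B = of_nat n} \<in> sets (config_space M)"
proof -
  have "{\<gamma> \<in> space (config_space M). \<forall>p\<in>F. emeasure \<gamma> (fst p) = of_nat (snd p)} \<in> sets (config_space M)"
    using assms by (intro sets.sets_Collect_finite_All) measurable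
  then show ?thesis by (simp add: case_prod_unfold)
qed

text \<open>Events prescribing finitely many finite counts form an intersection-stable generator, so
  it is enough that their probabilities depend measurably on \<open>s\<close>. Constraints are added
  one at a time, each as a coefficient of a generating function.\<close>

lemma measurable_config_kernelI:
  assumes K: "\<And>s. s \<in> space S \<Longrightarrow> prob_space (K s)"
      "\<And>s. s \<in> space S \<Longrightarrow> sets (K s) = sets (config_space M)"
    and laplace: "\<And>g. g \<in> borel_measurable M \<Longrightarrow>
      (\<lambda>s. \<integral>\<^sup>+ \<gamma>. ennreal (exp_neg (\<integral>\<^sup>+ x. g x \<partial>\<gamma>)) \<partial>K s) \<in> borel_measurable S"
  shows "K \<in> measurable S (subprob_algebra (config_space M))"
proof -
  let ?A = "\<lambda>F. {\<gamma> \<in> gen_configs M. \<forall>(B, n)\<in>F. emeasure \<gamma> B = of_nat (n :: nat)}"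
  let ?G = "{?A F | F. finite F \<and> F \<subseteq> sets M \<times> UNIV}"
  have space_K: "space (K s) = gen_configs M" if "s \<in> space S" for s
    using K(2)[OF that] by (auto dest: sets_eq_imp_space_eq)
  \<comment> \<open>The factor with an arbitrary \<open>g\<close> strengthens the induction: a new
    constraint needs the claim for \<open>g\<close> perturbed by a multiple of an indicator. In the
    end \<open>g = 0\<close> leaves the plain probability.\<close>
  have *: "(\<lambda>s. \<integral>\<gamma>. indicator (?A F) \<gamma> * exp_neg (\<integral>\<^sup>+ x. g x \<partial>\<gamma>) \<partial>K s) \<in> borel_measurable S"
    if "finite F" "F \<subseteq> sets M \<times> UNIV" "g \<in> borel_measurable M" for F g
    using that
  proof (induction F arbitrary: g rule: finite_induct)
    case empty
    note [measurable] = measurable_nn_integral_config_space[OF empty(2)] laplace[OF empty(2)]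
    have "(\<integral>\<gamma>. indicator (?A {}) \<gamma> * exp_neg (\<integral>\<^sup>+ x. g x \<partial>\<gamma>) \<partial>K s)
        = enn2real (\<integral>\<^sup>+ \<gamma>. ennreal (exp_neg (\<integral>\<^sup>+ x. g x \<partial>\<gamma>)) \<partial>K s)" if s: "s \<in> space S" for s
    proof -
      note [measurable_cong] = K(2)[OF s]
      have "(\<integral>\<gamma>. indicator (?A {}) \<gamma> * exp_neg (\<integral>\<^sup>+ x. g x \<partial>\<gamma>) \<partial>K s)
          = (\<integral>\<gamma>. exp_neg (\<integral>\<^sup>+ x. g x \<partial>\<gamma>) \<partial>K s)"
        using s by (intro Bochner_Integration.integral_cong refl) (simp add: space_K)
      also have "\<dots> = enn2real (\<integral>\<^sup>+ \<gamma>. ennreal (exp_neg (\<integral>\<^sup>+ x. g x \<partial>\<gamma>)) \<partial>K s)"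
        by (intro integral_eq_nn_integral) auto
      finally show ?thesis .
    qed
    moreover have "(\<lambda>s. enn2real (\<integral>\<^sup>+ \<gamma>. ennreal (exp_neg (\<integral>\<^sup>+ x. g x \<partial>\<gamma>)) \<partial>K s)) \<in> borel_measurable S"
      by measurable
    ultimately show ?case
      by (simp only: cong: measurable_cong)
  next
    case (insert p F)
    obtain B n where p: "p = (B, n)" by (cases p)
    have B [measurable]: "B \<in> sets M" and F: "finite F" "F \<subseteq> sets M \<times> UNIV"
      and g [measurable]: "g \<in> borel_measurable M"
      using insert.hyps insert.prems by (simp_all add: p)
    note [measurable] = measurable_nn_integral_config_space[OF g]
      sets_config_space_finite_constraints[OF F]
    let ?R = "\<lambda>\<gamma>. indicator (?A F) \<gamma> * exp_neg (\<integral>\<^sup>+ x. g x \<partial>\<gamma>)"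
    have "(\<lambda>s. \<integral>\<gamma>. ?R \<gamma> * indicator {\<gamma>. emeasure \<gamma> B = of_nat n} \<gamma> \<partial>K s) \<in> borel_measurable S"
    proof (rule borel_measurable_integral_indicator_eq_of_nat[where T = "config_space M"])
      fix t :: real assume "0 < t"
      \<comment> \<open>Moving \<open>t * emeasure \<gamma> B\<close> into the exponent adds
        \<open>t * indicator B\<close> to \<open>g\<close>, and the induction hypothesis for
        \<open>F\<close> covers the new function.\<close>
      have "(\<lambda>s. \<integral>\<gamma>. indicator (?A F) \<gamma> * exp_neg (\<integral>\<^sup>+ x. g x + ennreal t * indicator B x \<partial>\<gamma>) \<partial>K s)
          \<in> borel_measurable S"
        by (intro insert.IH F) measurable
      moreover have "(\<integral>\<gamma>. indicator (?A F) \<gamma> * exp_neg (\<integral>\<^sup>+ x. g x + ennreal t * indicator B x \<partial>\<gamma>) \<partial>K s)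
          = (\<integral>\<gamma>. ?R \<gamma> * exp_neg (ennreal t * emeasure \<gamma> B) \<partial>K s)" if s: "s \<in> space S" for s
      proof (intro Bochner_Integration.integral_cong refl)
        fix \<gamma> assume "\<gamma> \<in> space (K s)"
        then have [measurable_cong]: "sets \<gamma> = sets M"
          using s by (simp add: space_K sets_gen_configs)
        show "indicator (?A F) \<gamma> * exp_neg (\<integral>\<^sup>+ x. g x + ennreal t * indicator B x \<partial>\<gamma>)
          = ?R \<gamma> * exp_neg (ennreal t * emeasure \<gamma> B)"
          by (simp add: nn_integral_add nn_integral_cmult_indicator exp_neg_add)
      qed
      ultimately show "(\<lambda>s. \<integral>\<gamma>. ?R \<gamma> * exp_neg (ennreal t * emeasure \<gamma> B) \<partial>K s) \<in> borel_measurable S"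
        by (simp cong: measurable_cong)
    qed (use K in \<open>auto simp: mult_le_one intro: emeasure_gen_configs_cases split: split_indicator\<close>)
    moreover have "(\<integral>\<gamma>. ?R \<gamma> * indicator {\<gamma>. emeasure \<gamma> B = of_nat n} \<gamma> \<partial>K s)
      = (\<integral>\<gamma>. indicator (?A (insert p F)) \<gamma> * exp_neg (\<integral>\<^sup>+ x. g x \<partial>\<gamma>) \<partial>K s)" for s
      by (intro Bochner_Integration.integral_cong refl) (auto simp: p split: split_indicator)
    ultimately show ?case by simp
  qed
  show ?thesis
  proof (rule measurable_subprob_algebra_generated)
    show "sets (config_space M) = sigma_sets (gen_configs M) ?G"
    proof (rule antisym)
      have "{\<gamma> \<in> gen_configs M. emeasure \<gamma> B = of_nat n} \<in> ?G" if "B \<in> sets M" for B and n :: nat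
        using that by (intro CollectI exI[of _ "{(B, n)}"]) auto
      then show "sets (config_space M) \<subseteq> sigma_sets (gen_configs M) ?G"
        unfolding sets_config_space by (intro sigma_sets_mono) (auto intro: sigma_sets.Basic)
      show "sigma_sets (gen_configs M) ?G \<subseteq> sets (config_space M)"
        using sets_config_space_finite_constraints sets.sigma_sets_subset[of ?G "config_space M"] by auto
    qed
    show "Int_stable ?G"
    proof (rule Int_stableI)
      fix a b assume "a \<in> ?G" "b \<in> ?G"
      then obtain F F' where "a = ?A F" "b = ?A F'" "finite F" "finite F'"
        "F \<subseteq> sets M \<times> UNIV" "F' \<subseteq> sets M \<times> UNIV" by blast
      then show "a \<inter> b \<in> ?G"
        by (intro CollectI exI[of _ "F \<union> F'"]) auto
    qed
    show "?G \<subseteq> Pow (gen_configs M)" by auto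
    show "subprob_space (K s)" "sets (K s) = sets (config_space M)" if "s \<in> space S" for s
      using K that by (auto intro: prob_space_imp_subprob_space)
    show "(\<lambda>s. emeasure (K s) A) \<in> borel_measurable S" if "A \<in> ?G" for A
    proof -
      from that obtain F where A: "A = ?A F" and F: "finite F" "F \<subseteq> sets M \<times> UNIV" by blast
      have "emeasure (K s) A = ennreal (\<integral>\<gamma>. indicator A \<gamma> * exp_neg (\<integral>\<^sup>+ x. 0 \<partial>\<gamma>) \<partial>K s)"
        if s: "s \<in> space S" for s
      proof -
        interpret prob_space "K s" using K(1)[OF s] .
        have "A \<in> sets (K s)"
          using K(2)[OF s] sets_config_space_finite_constraints[OF F] A by simp
        then show ?thesis by (simp add: emeasure_eq_measure)
      qed
      moreover have "(\<lambda>s. ennreal (\<integral>\<gamma>. indicator A \<gamma> * exp_neg (\<integral>\<^sup>+ x. 0 \<partial>\<gamma>) \<partial>K s)) \<in> borel_measurable S"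
        unfolding A by (intro measurable_compose[OF _ measurable_ennreal] *[OF F]) simp
      ultimately show ?thesis
        by (simp cong: measurable_cong)
    qed
    have "emeasure (K s) (gen_configs M) = 1" if "s \<in> space S" for s
      using prob_space.emeasure_space_1[OF K(1)[OF that]] space_K[OF that] by simp
    then show "(\<lambda>s. emeasure (K s) (gen_configs M)) \<in> borel_measurable S"
      by (simp cong: measurable_cong)
  qed
qed


section \<open>Random superpositions\<close>

lemma borel_measurable_nn_integral_count_space [measurable]:
  assumes "countable I" and [measurable]: "\<And>i. i \<in> I \<Longrightarrow> f i \<in> borel_measurable M"
  shows "(\<lambda>w. \<integral>\<^sup>+ i. f i w \<partial>count_space I) \<in> borel_measurable M"
  unfolding nn_integral_count_space_SUP[OF assms(1)] by measurable

lemma measurable_superpose: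
  assumes I: "countable I"
    and \<nu> [measurable]: "\<And>i. i \<in> I \<Longrightarrow> \<nu> i \<in> measurable S (config_space M)"
  shows "(\<lambda>w. superpose I M (\<lambda>i. \<nu> i w)) \<in> measurable S (config_space M)"
proof (rule measurable_config_spaceI)
  have gen: "\<nu> i w \<in> gen_configs M" if "i \<in> I" "w \<in> space S" for i w
    using measurable_space[OF \<nu>] that by simp
  then show "(\<lambda>w. superpose I M (\<lambda>i. \<nu> i w)) \<in> space S \<rightarrow> gen_configs M"
    using I by (auto intro!: gen_configs_superpose)
  fix B assume B: "B \<in> sets M"
  have [measurable]: "(\<lambda>w. emeasure (\<nu> i w) B) \<in> borel_measurable S" if "i \<in> I" for i
    using measurable_compose[OF \<nu>[OF that] measurable_emeasure_config_space] .
  have "(\<lambda>w. \<integral>\<^sup>+ i. emeasure (\<nu> i w) B \<partial>count_space I) \<in> borel_measurable S"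
    by (rule borel_measurable_nn_integral_count_space[OF I]) simp
  moreover have "emeasure (superpose I M (\<lambda>i. \<nu> i w)) B = (\<integral>\<^sup>+ i. emeasure (\<nu> i w) B \<partial>count_space I)"
    if "w \<in> space S" for w
    using B gen[OF _ that] by (intro emeasure_superpose sets_gen_configs)
  ultimately show "(\<lambda>w. emeasure (superpose I M (\<lambda>i. \<nu> i w)) B) \<in> borel_measurable S"
    by (simp cong: measurable_cong)
qed

lemma gen_configs_return:
  assumes "x \<in> space M"
  shows "return M x \<in> gen_configs M"
proof -
  have "superpose {0 :: nat} M (\<lambda>_. return M x) = return M x"
    by (rule measure_eqI) (auto simp: emeasure_superpose nn_integral_count_space_finite)
  then show ?thesis
    using gen_configs_superpose_return[of "{0 :: nat}" "\<lambda>_. x" M] assms by simp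
qed

lemma measurable_return_config_space:
  "return M \<in> measurable M (config_space M)"
  by (rule measurable_config_spaceI) (auto simp: gen_configs_return)

text \<open>Both sides are determined by their values on finite-dimensional cylinders. The preimage
  of a cylinder under the coordinatewise map is the cylinder over the preimages of the sets
  \<open>A i\<close>, whose mass is a product.\<close>

lemma distr_PiM_componentwise:
  assumes M: "\<And>i. i \<in> I \<Longrightarrow> prob_space (M i)"
    and f [measurable]: "\<And>i. i \<in> I \<Longrightarrow> f i \<in> measurable (M i) (N i)"
  shows "PiM I (\<lambda>i. distr (M i) (N i) (f i)) = distr (PiM I M) (PiM I N) (\<lambda>\<omega>. \<lambda>i\<in>I. f i (\<omega> i))"
proof (rule measure_eqI_PiM_infinite[OF refl])
  let ?D = "\<lambda>i. distr (M i) (N i) (f i)"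
  have D: "prob_space (?D i)" if "i \<in> I" for i
    using M f that by (intro prob_space.prob_space_distr)
  have meas [measurable]: "(\<lambda>\<omega>. \<lambda>i\<in>I. f i (\<omega> i)) \<in> measurable (PiM I M) (PiM I N)"
    by measurable
  have sets_D: "sets (PiM I ?D) = sets (PiM I N)"
    by (intro sets_PiM_cong) auto
  then show "sets (distr (PiM I M) (PiM I N) (\<lambda>\<omega>. \<lambda>i\<in>I. f i (\<omega> i))) = sets (PiM I ?D)"
    by simp
  show "finite_measure (PiM I ?D)"
    using prob_space_PiM[of I ?D] D by (simp add: prob_space_def)
  fix A J assume J: "finite J" "J \<subseteq> I" and A: "\<And>i. i \<in> J \<Longrightarrow> A i \<in> sets (?D i)"
  let ?X = "prod_emb I ?D J (Pi\<^sub>E J A)"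
  have X: "?X \<in> sets (PiM I N)"
    unfolding sets_D[symmetric] using J A by (intro sets_PiM_I) blast+
  have "(\<lambda>\<omega>. \<lambda>i\<in>I. f i (\<omega> i)) -` ?X \<inter> space (PiM I M)
      = prod_emb I M J (\<Pi>\<^sub>E i\<in>J. f i -` A i \<inter> space (M i))"
    using J f[THEN measurable_space]
    by (auto simp: prod_emb_def space_PiM PiE_iff extensional_def subset_iff)
  then have "emeasure (distr (PiM I M) (PiM I N) (\<lambda>\<omega>. \<lambda>i\<in>I. f i (\<omega> i))) ?X
      = (\<Prod>i\<in>J. emeasure (M i) (f i -` A i \<inter> space (M i)))"
    using J M A X by (simp add: emeasure_distr emeasure_PiM_emb measurable_sets[OF f] subset_iff)
  also have "\<dots> = (\<Prod>i\<in>J. emeasure (?D i) (A i))"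
    using J A by (intro prod.cong refl) (simp add: emeasure_distr subset_iff)
  also have "\<dots> = emeasure (PiM I ?D) ?X"
    using J A D by (intro emeasure_PiM_emb[symmetric]) auto
  finally show "emeasure (PiM I ?D) ?X
    = emeasure (distr (PiM I M) (PiM I N) (\<lambda>\<omega>. \<lambda>i\<in>I. f i (\<omega> i))) ?X" ..
qed

section \<open>Vectors and marked points\<close>

lemma space_borel_of [simp]: "space (borel_of T) = topspace T"
  unfolding borel_of_def by (rule space_measure_of) (use openin_subset in blast)

lemma sets_borel_of: "sets (borel_of T) = sigma_sets (topspace T) {U. openin T U}"
  unfolding borel_of_def by (rule sets_measure_of) (use openin_subset in blast)

lemma openin_imp_sets_borel_of: "openin T U \<Longrightarrow> U \<in> sets (borel_of T)"
  by (simp add: sets_borel_of sigma_sets.Basic)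

text \<open>In the disjoint union topology every set of lengths has an open preimage, as its slice
  at each \<open>n\<close> is either everything or empty.\<close>

lemma measurable_vect_length [measurable]: 
  "fst \<in> measurable (vect_borel :: 'a::topological_space vect measure) (count_space UNIV)"
proof (rule measurableI)
  fix A :: "enat set"
  have "openin vect_topology (fst -` A \<inter> topspace (vect_topology :: 'a vect topology))"
    unfolding vect_topology_def openin_sum_topology
  proof (intro conjI ballI)
    fix n :: enat
    let ?T = "product_topology (\<lambda>_. euclidean :: 'a topology) {i. enat i < n}"
    have "{y. (n, y) \<in> fst -` A \<inter> topspace (sum_topology (\<lambda>n. product_topology (\<lambda>_. euclidean) {i. enat i < n}) UNIV)}
        = (if n \<in> A then topspace ?T else {})"
      by auto
    then show "openin ?T {y. (n, y) \<in> fst -` A \<inter>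
        topspace (sum_topology (\<lambda>n. product_topology (\<lambda>_. euclidean) {i. enat i < n}) UNIV)}"
      by (simp only: openin_topspace openin_empty simp_thms split: if_split)
  qed auto
  then show "fst -` A \<inter> space vect_borel \<in> sets (vect_borel :: 'a vect measure)"
    by (simp add: openin_imp_sets_borel_of)
qed simp

text \<open>The coordinates beyond the length of a vector have the constant value \<^term>\<open>undefined\<close>.\<close>

lemma measurable_vect_coordinate [measurable]: "(\<lambda>v. snd v i) \<in> borel_measurable vect_borel"
proof (rule borel_measurableI)
  fix S :: "'a set" assume S: "open S"
  let ?T = "\<lambda>n. product_topology (\<lambda>_. euclidean :: 'a topology) {i. enat i < n}"
  have "openin vect_topology ((\<lambda>v. snd v i) -` S \<inter> topspace vect_topology)"
    unfolding vect_topology_def openin_sum_topology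
  proof (intro conjI ballI)
    fix n :: enat
    show "openin (?T n) {y. (n, y) \<in> (\<lambda>v. snd v i) -` S \<inter> topspace (sum_topology ?T UNIV)}"
    proof (cases "enat i < n")
      case True
      then have "continuous_map (?T n) euclidean (\<lambda>y. y i)"
        by (intro continuous_map_product_projection) simp
      then have "openin (?T n) {y \<in> topspace (?T n). y i \<in> S}"
        by (rule openin_continuous_map_preimage) (simp add: S)
      also have "{y \<in> topspace (?T n). y i \<in> S}
          = {y. (n, y) \<in> (\<lambda>v. snd v i) -` S \<inter> topspace (sum_topology ?T UNIV)}"
        by auto
      finally show ?thesis .
    next
      case False
      then have "{y. (n, y) \<in> (\<lambda>v. snd v i) -` S \<inter> topspace (sum_topology ?T UNIV)}
          = (if undefined \<in> S then topspace (?T n) else {})"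
        by (auto simp: PiE_iff extensional_def)
      then show ?thesis
        by (simp only: openin_topspace openin_empty split: if_split) simp
    qed
  qed auto
  then show "(\<lambda>v. snd v i) -` S \<inter> space vect_borel \<in> sets vect_borel"
    by (simp add: openin_imp_sets_borel_of)
qed

text \<open>A vector is determined by its length and its coordinates at all indices, those beyond
  the length being fixed. This is a countable intersection of measurable conditions, since points
  are closed.\<close>

lemma sets_vect_borel_singleton:
  fixes v :: "'a::t1_space vect"
  assumes "v \<in> space vect_borel"
  shows "{v} \<in> sets vect_borel"
proof -
  have "{v} = {w \<in> space vect_borel. fst w = fst v \<and> (\<forall>i. snd w i = snd v i)}"
    using assms by (auto simp: prod_eq_iff fun_eq_iff)
  also have "\<dots> \<in> sets vect_borel"
  proof -
    have [measurable]: "{w \<in> space vect_borel. snd w i = snd v i} \<in> sets vect_borel" for i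
    proof -
      have "(\<lambda>w. snd w i) -` {snd v i} \<inter> space vect_borel \<in> sets vect_borel"
        by (rule measurable_sets[OF measurable_vect_coordinate]) simp
      then show ?thesis by (simp add: vimage_def Int_def conj_commute)
    qed
    show ?thesis by measurable
  qed
  finally show ?thesis .
qed

text \<open>An open set of the product is the union, over a countable base of the first factor, of the
  largest open boxes contained in it; the second factor needs no countability.\<close>

lemma sets_marked_borel [measurable_cong]:
  "sets marked_borel = sets (borel \<Otimes>\<^sub>M (vect_borel :: 'a::second_countable_topology vect measure))"
proof (rule antisym)
  obtain \<B> :: "'a set set" where \<B>: "countable \<B>" "topological_basis \<B>"
    using ex_countable_basis by blast
  have "U \<in> sets (borel \<Otimes>\<^sub>M vect_borel)" if U: "openin marked_topology U" for U :: "('a \<times> 'a vect) set"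
  proof -
    define W where "W b = \<Union>{V. openin vect_topology V \<and> b \<times> V \<subseteq> U}" for b :: "'a set"
    have "U = (\<Union>b\<in>\<B>. b \<times> W b)"
    proof (intro antisym subsetI)
      fix z assume "z \<in> U"
      then obtain x v where z: "z = (x, v)" "(x, v) \<in> U" by (cases z) auto
      from U[unfolded marked_topology_def openin_prod_topology_alt, rule_format, OF z(2)]
      obtain A V where AV: "open A" "openin vect_topology V" "x \<in> A" "v \<in> V" "A \<times> V \<subseteq> U"
        by (metis open_openin)
      with \<B>(2) obtain b where b: "b \<in> \<B>" "x \<in> b" "b \<subseteq> A"
        by (elim topological_basisE)
      then have "b \<times> V \<subseteq> U" using AV(5) by blast
      then have "v \<in> W b" using AV by (auto simp: W_def)
      with b z show "z \<in> (\<Union>b\<in>\<B>. b \<times> W b)" by auto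
    qed (auto simp: W_def)
    also have "\<dots> \<in> sets (borel \<Otimes>\<^sub>M vect_borel)"
    proof (intro sets.countable_UN'' \<B>(1) pair_measureI)
      fix b assume "b \<in> \<B>"
      with \<B>(2) show "b \<in> sets borel"
        by (simp add: topological_basis_open)
      show "W b \<in> sets vect_borel"
        unfolding W_def by (intro openin_imp_sets_borel_of openin_Union) auto
    qed
    finally show ?thesis .
  qed
  moreover have "topspace marked_topology = space (borel \<Otimes>\<^sub>M (vect_borel :: 'a vect measure))"
    by (simp add: marked_topology_def space_pair_measure)
  ultimately show "sets marked_borel \<subseteq> sets (borel \<Otimes>\<^sub>M (vect_borel :: 'a vect measure))"
    unfolding sets_borel_of by (auto intro!: sets.sigma_sets_subset)
next
  \<comment> \<open>For the other inclusion, continuity of the two projections makes the identity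
    measurable into the product sigma-algebra.\<close>
  have meas: "f \<in> measurable (borel_of T) (borel_of T')" if f: "continuous_map T T' f"
    for f :: "'b \<Rightarrow> 'c" and T T'
    unfolding borel_of_def[of T']
  proof (rule measurable_measure_of)
    fix V assume "V \<in> {U. openin T' U}"
    then have "openin T {x \<in> topspace T. f x \<in> V}"
      using f by (auto intro: openin_continuous_map_preimage)
    then show "f -` V \<inter> space (borel_of T) \<in> sets (borel_of T)"
      by (intro openin_imp_sets_borel_of) (simp add: vimage_def Int_def conj_commute)
  qed (use f in \<open>auto simp: continuous_map_def dest: openin_subset\<close>)
  have "borel_of (euclidean :: 'a topology) = borel"
    by (simp add: borel_of_def borel_def)
  then have id_measurable: "(\<lambda>z. (fst z, snd z)) \<in> measurable marked_borel (borel \<Otimes>\<^sub>M (vect_borel :: 'a vect measure))"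
    using meas[OF continuous_map_fst, of "euclidean :: 'a topology" "vect_topology :: 'a vect topology"]
      meas[OF continuous_map_snd, of "euclidean :: 'a topology" "vect_topology :: 'a vect topology"]
    by (intro measurable_Pair) (simp_all add: marked_topology_def)
  have "A \<in> sets marked_borel" if A: "A \<in> sets (borel \<Otimes>\<^sub>M (vect_borel :: 'a vect measure))" for A
  proof -
    have "A \<subseteq> space (marked_borel :: ('a \<times> 'a vect) measure)"
      using sets.sets_into_space[OF A] by (simp add: space_pair_measure marked_topology_def)
    then show ?thesis
      using measurable_sets[OF id_measurable A] by (simp add: Int_absorb2)
  qed
  then show "sets (borel \<Otimes>\<^sub>M (vect_borel :: 'a vect measure)) \<subseteq> sets marked_borel" ..
qed

lemma space_marked_borel: "space (marked_borel :: ('a::topological_space \<times> 'a vect) measure) = UNIV \<times> space vect_borel"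
  by (simp add: marked_topology_def)

lemma sets_marked_borel_singleton:
  fixes z :: "'a::{second_countable_topology, t1_space} \<times> 'a vect"
  assumes "z \<in> space marked_borel"
  shows "{z} \<in> sets marked_borel"
proof -
  have "{fst z} \<times> {snd z} \<in> sets (borel \<Otimes>\<^sub>M vect_borel)"
    using assms unfolding space_marked_borel
    by (intro pair_measureI sets_vect_borel_singleton) (auto simp: mem_Times_iff)
  then show ?thesis by (simp add: sets_marked_borel)
qed

lemma vect_config_in_gen_configs [simp]: "vect_config v \<in> gen_configs borel"
  by (cases v) (simp add: gen_configs_superpose_return)

lemma marked_config_in_gen_configs [simp]: "marked_config z \<in> gen_configs borel"
  by (cases z) (simp del: vect_config.simps vect_shift.simps)

text \<open>The index set of the coordinates varies with the vector. As a series over all naturals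
  with a condition on the length, the sum is measurable term by term.\<close>

lemma emeasure_vect_config:
  assumes "B \<in> sets borel"
  shows "emeasure (vect_config v) B = (\<Sum>i. if enat i < fst v then indicator B (snd v i) else 0)"
proof (cases v)
  case (Pair n y)
  have "emeasure (vect_config v) B = (\<integral>\<^sup>+ i. indicator B (y i) \<partial>count_space {i. enat i < n})"
    using assms by (simp add: Pair emeasure_superpose)
  also have "\<dots> = (\<integral>\<^sup>+ i. (if enat i < n then indicator B (y i) else 0) \<partial>count_space UNIV)"
    by (subst nn_integral_count_space_UNIV) (auto intro!: nn_integral_cong)
  finally show ?thesis
    by (simp add: Pair nn_integral_count_space_nat cong: if_cong del: vect_config.simps)
qed

lemma measurable_vect_config [measurable]: "vect_config \<in> measurable vect_borel (config_space borel)"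
proof (rule measurable_config_spaceI)
  fix B :: "'a set" assume [measurable]: "B \<in> sets borel"
  show "(\<lambda>v. emeasure (vect_config v) B) \<in> borel_measurable vect_borel"
    unfolding emeasure_vect_config[OF \<open>B \<in> sets borel\<close>] by measurable
qed simp

lemma fst_vect_shift: "fst (vect_shift x v) = fst v"
  by (cases v) simp

lemma snd_vect_shift: "enat i < fst v \<Longrightarrow> snd (vect_shift x v) i = snd v i + x"
  by (cases v) simp

text \<open>In the series for the mass of \<open>B\<close>, the points
  \<open>snd (snd z) i + fst z\<close> depend measurably on centre and mark jointly, addition being
  continuous on a second countable space.\<close>

lemma measurable_marked_config [measurable]:
  "marked_config \<in> measurable marked_borel
    (config_space (borel :: 'a::{second_countable_topology, topological_monoid_add} measure))"
proof (rule measurable_config_spaceI)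
  fix B :: "'a set" assume B [measurable]: "B \<in> sets borel"
  have "emeasure (marked_config z) B
      = (\<Sum>i. if enat i < fst (snd z) then indicator B (snd (snd z) i + fst z) else 0)" for z :: "'a \<times> 'a vect"
    by (cases z) (auto simp: emeasure_vect_config[OF B] fst_vect_shift snd_vect_shift simp del: vect_config.simps vect_shift.simps
        intro!: suminf_cong)
  then show "(\<lambda>z. emeasure (marked_config z) B) \<in> borel_measurable marked_borel"
    by simp measurable
qed simp

lemma measurable_marked_Pair [measurable]:
  "Pair x \<in> measurable vect_borel (marked_borel :: ('a::second_countable_topology \<times> 'a vect) measure)"
  by measurable


section \<open>Clusters as images of marks\<close>

text \<open>Evaluated at \<open>B\<close>, the sum over the points of \<gamma> is the integral of
  \<open>emeasure (marked_config z) B\<close> against \<gamma>, and such integrals are measurable in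
  \<gamma>.\<close>

lemma measurable_marked_config_lift:
  "marked_config_lift \<in> measurable (config_space marked_borel)
    (config_space (borel :: 'a::{second_countable_topology, t1_space, topological_monoid_add} measure))"
  (is "_ \<in> measurable ?S _")
proof (rule measurable_config_spaceI)
  show "marked_config_lift \<in> space ?S \<rightarrow> gen_configs (borel :: 'a measure)"
    unfolding marked_config_lift_def
    by (intro Pi_I gen_configs_superpose) (auto intro: countable_config_points simp del: marked_config.simps)
  fix B :: "'a set" assume B: "B \<in> sets borel"
  have f: "(\<lambda>z. emeasure (marked_config z) B) \<in> borel_measurable marked_borel"
    by (rule measurable_compose[OF measurable_marked_config measurable_emeasure_config_space])
  have "emeasure (marked_config_lift \<gamma>) B = (\<integral>\<^sup>+ z. emeasure (marked_config z) B \<partial>\<gamma>)"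
    if "\<gamma> \<in> space ?S" for \<gamma>
  proof -
    have "emeasure (marked_config_lift \<gamma>) B
        = (\<integral>\<^sup>+ (z, k). emeasure (marked_config z) B \<partial>count_space (config_points \<gamma>))"
      unfolding marked_config_lift_def using B
      by (subst emeasure_superpose) (auto simp: case_prod_unfold sets_gen_configs simp del: marked_config.simps)
    also have "\<dots> = (\<integral>\<^sup>+ z. emeasure (marked_config z) B \<partial>\<gamma>)"
      using that by (intro nn_integral_config_points[OF _ sets_marked_borel_singleton f]) simp_all
    finally show ?thesis .
  qed
  then show "(\<lambda>\<gamma>. emeasure (marked_config_lift \<gamma>) B) \<in> borel_measurable ?S"
    using measurable_nn_integral_config_space[OF f] by (subst measurable_cong)
qed

text \<open>\<open>marked_config_lift\<close> runs over \<open>config_points\<close>, where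
  coinciding \<open>z i\<close> are merged into multiplicities. Both sides equal an integral against
  the superposition, which does not depend on how the points are listed.\<close>

lemma marked_config_lift_superpose_return:
  fixes z :: "'i \<Rightarrow> 'a::{second_countable_topology, t1_space, topological_monoid_add} \<times> 'a vect"
  assumes I: "countable I" and z: "z \<in> I \<rightarrow> space marked_borel"
  shows "marked_config_lift (superpose I marked_borel (\<lambda>i. return marked_borel (z i)))
    = superpose I borel (\<lambda>i. marked_config (z i))"
proof (rule measure_eqI)
  let ?\<gamma> = "superpose I marked_borel (\<lambda>i. return marked_borel (z i))"
  show "sets (marked_config_lift ?\<gamma>) = sets (superpose I borel (\<lambda>i. marked_config (z i)))"
    by (simp add: marked_config_lift_def)
  fix B assume "B \<in> sets (marked_config_lift ?\<gamma>)"
  then have B: "B \<in> sets borel" by (simp add: marked_config_lift_def)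
  have f: "(\<lambda>z. emeasure (marked_config z) B) \<in> borel_measurable marked_borel"
    by (rule measurable_compose[OF measurable_marked_config measurable_emeasure_config_space])
  have "emeasure (marked_config_lift ?\<gamma>) B
      = (\<integral>\<^sup>+ (z, k). emeasure (marked_config z) B \<partial>count_space (config_points ?\<gamma>))"
    unfolding marked_config_lift_def using B
    by (subst emeasure_superpose) (auto simp: case_prod_unfold sets_gen_configs simp del: marked_config.simps)
  also have "\<dots> = (\<integral>\<^sup>+ z. emeasure (marked_config z) B \<partial>?\<gamma>)"
    using gen_configs_superpose_return[OF I z]
    by (rule nn_integral_config_points[OF _ sets_marked_borel_singleton f])
  also have "\<dots> = (\<integral>\<^sup>+ i. (\<integral>\<^sup>+ z. emeasure (marked_config z) B \<partial>return marked_borel (z i)) \<partial>count_space I)"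
    using f by (intro nn_integral_superpose) simp_all
  also have "\<dots> = (\<integral>\<^sup>+ i. emeasure (marked_config (z i)) B \<partial>count_space I)"
    using z f by (intro nn_integral_cong nn_integral_return) auto
  also have "\<dots> = emeasure (superpose I borel (\<lambda>i. marked_config (z i))) B"
    using B by (intro emeasure_superpose[symmetric]) (simp_all add: sets_gen_configs del: marked_config.simps)
  finally show "emeasure (marked_config_lift ?\<gamma>) B
    = emeasure (superpose I borel (\<lambda>i. marked_config (z i))) B" .
qed

section \<open>Translations of configurations\<close>

context
  fixes x :: "'a::{second_countable_topology, topological_monoid_add}"
begin

lemma measurable_add_right: "(\<lambda>y. y + x) \<in> borel_measurable borel"
  by measurable

lemma config_shift_superpose_return:
  "config_shift x (superpose I borel (\<lambda>i. return borel (y i))) = superpose I borel (\<lambda>i. return borel (y i + x))"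
proof (rule measure_eqI)
  fix B assume "B \<in> sets (config_shift x (superpose I borel (\<lambda>i. return borel (y i))))"
  then have B: "B \<in> sets borel" by (simp add: config_shift_def)
  have "(\<lambda>y. y + x) \<in> measurable (superpose I borel (\<lambda>i. return borel (y i))) borel"
    by measurable
  moreover have "(\<lambda>y. y + x) -` B \<in> sets borel"
    using measurable_sets[OF measurable_add_right B] by simp
  ultimately show "emeasure (config_shift x (superpose I borel (\<lambda>i. return borel (y i)))) B
    = emeasure (superpose I borel (\<lambda>i. return borel (y i + x))) B"
    using B by (simp add: config_shift_def emeasure_distr emeasure_superpose_return)
qed (simp add: config_shift_def)

lemma config_shift_in_gen_configs:
  assumes "\<gamma> \<in> gen_configs borel"
  shows "config_shift x \<gamma> \<in> gen_configs borel"
  using assms by (elim gen_configsE) (simp add: config_shift_superpose_return gen_configs_superpose_return)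

lemma measurable_config_shift: "config_shift x \<in> measurable (config_space borel) (config_space borel)"
proof (rule measurable_config_spaceI)
  fix B :: "'a set" assume B: "B \<in> sets borel"
  have "emeasure (config_shift x \<gamma>) B = emeasure \<gamma> ((\<lambda>y. y + x) -` B)"
    if "\<gamma> \<in> space (config_space borel)" for \<gamma>
  proof -
    from that have [measurable_cong]: "sets \<gamma> = sets borel"
      by (simp add: sets_gen_configs)
    have "(\<lambda>y. y + x) \<in> measurable \<gamma> borel" by measurable
    with B show ?thesis
      using sets_eq_imp_space_eq[OF \<open>sets \<gamma> = sets borel\<close>] by (simp add: config_shift_def emeasure_distr)
  qed
  then show "(\<lambda>\<gamma>. emeasure (config_shift x \<gamma>) B) \<in> borel_measurable (config_space borel)"
    using measurable_emeasure_config_space by (subst measurable_cong)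
qed (simp add: config_shift_in_gen_configs)

lemma config_shift_vect_config: "config_shift x (vect_config v) = vect_config (vect_shift x v)"
  by (cases v) (auto simp: config_shift_superpose_return intro!: superpose_cong)

end

lemma config_shift_config_shift_minus:
  fixes x :: "'a::{second_countable_topology, topological_monoid_add, group_add}"
  assumes "\<gamma> \<in> gen_configs borel"
  shows "config_shift x (config_shift (- x) \<gamma>) = \<gamma>"
  using assms by (elim gen_configsE) (simp add: config_shift_superpose_return add.assoc)

text \<open>Translations by \<open>x\<close> and \<open>- x\<close> are mutually inverse on
  configurations. This rewrites the image in \<open>cluster_at\<close> as a preimage under a
  measurable map.\<close>

lemma image_config_shift_minus:
  fixes x :: "'a::{second_countable_topology, topological_monoid_add, group_add}"
  assumes "A \<subseteq> gen_configs borel"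
  shows "config_shift (- x) ` A = config_shift x -` A \<inter> gen_configs borel"
proof (intro antisym subsetI)
  fix \<gamma> assume "\<gamma> \<in> config_shift x -` A \<inter> gen_configs borel"
  moreover from this have "config_shift (- x) (config_shift x \<gamma>) = \<gamma>"
    using config_shift_config_shift_minus[of \<gamma> "- x"] by simp
  ultimately show "\<gamma> \<in> config_shift (- x) ` A"
    by (metis IntD1 image_eqI vimageE)
qed (use assms in \<open>auto simp: config_shift_config_shift_minus config_shift_in_gen_configs subset_iff\<close>)

text \<open>Translating the configuration of a vector amounts to translating its coordinates, so
  pulling back \<open>A\<close> shifted by \<open>- x\<close> along \<open>vect_config\<close> gives
  the preimage of \<open>A\<close> under \<open>v \<mapsto> marked_config (x, v)\<close>. The set
  function in \<open>cluster_at\<close> thus agrees with a push-forward and is a measure.\<close>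

lemma cluster_at_eq_distr:
  fixes \<eta> :: "'a::{second_countable_topology, topological_monoid_add, group_add} vect measure"
  assumes \<eta> [measurable_cong]: "sets \<eta> = sets vect_borel"
  shows "cluster_at \<eta> x = distr \<eta> (config_space borel) (\<lambda>v. marked_config (x, v))"
  unfolding cluster_at_def distr_def[of \<eta> _ "\<lambda>v. marked_config (x, v)"]
proof (rule measure_of_eq[OF sets.space_closed])
  fix A assume "A \<in> sigma_sets (space (config_space borel)) (sets (config_space (borel :: 'a measure)))"
  then have A: "A \<in> sets (config_space borel)" by (simp only: sets.sigma_sets_eq)
  have config: "vect_config \<in> measurable \<eta> (config_space borel)" by measurable
  have "config_shift (- x) ` A = config_shift x -` A \<inter> space (config_space borel)"
    using sets.sets_into_space[OF A] by (simp add: image_config_shift_minus)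
  moreover from this have "config_shift (- x) ` A \<in> sets (config_space borel)"
    using measurable_sets[OF measurable_config_shift A] by simp
  ultimately have "emeasure (centred_cluster \<eta>) (config_shift (- x) ` A)
      = emeasure \<eta> (vect_config -` (config_shift x -` A \<inter> space (config_space borel)) \<inter> space \<eta>)"
    unfolding centred_cluster_def by (simp add: emeasure_distr[OF config])
  also have "vect_config -` (config_shift x -` A \<inter> space (config_space borel)) \<inter> space \<eta>
      = (\<lambda>v. marked_config (x, v)) -` A \<inter> space \<eta>"
    by (auto simp: config_shift_vect_config simp del: vect_config.simps)
  finally show "emeasure (centred_cluster \<eta>) (config_shift (- x) ` A)
    = emeasure \<eta> ((\<lambda>v. marked_config (x, v)) -` A \<inter> space \<eta>)" .
qed

text \<open>The conditional law inside \<open>marked_measure\<close>, named so that its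
  measurability in \<gamma> can be stated.\<close>

definition marked_kernel ::
  "'a::topological_space vect measure \<Rightarrow> 'a measure \<Rightarrow> ('a \<times> 'a vect) measure measure"
where
  "marked_kernel \<eta> \<gamma> =
     distr (\<Pi>\<^sub>M _\<in>config_points \<gamma>. \<eta>) (config_space marked_borel)
       (\<lambda>v. superpose (config_points \<gamma>) marked_borel
         (\<lambda>(x, k). return marked_borel (x, v (x, k))))"

lemma measurable_superpose_marks:
  fixes \<eta> :: "'a::second_countable_topology vect measure"
  assumes [measurable_cong]: "sets \<eta> = sets vect_borel" and I: "countable I"
  shows "(\<lambda>v. superpose I marked_borel (\<lambda>(x, k). return marked_borel (x, v (x, k))))
    \<in> measurable (\<Pi>\<^sub>M _\<in>I. \<eta>) (config_space marked_borel)"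
  unfolding case_prod_unfold prod.collapse
  by (intro measurable_superpose I measurable_compose[OF _ measurable_return_config_space]
      measurable_compose[OF _ measurable_marked_Pair]) measurable

lemma measurable_marked_kernel:
  fixes \<eta> :: "'a::{second_countable_topology, t1_space} vect measure"
  assumes "prob_space \<eta>" and \<eta> [measurable_cong]: "sets \<eta> = sets vect_borel"
  shows "marked_kernel \<eta> \<in> measurable (config_space borel) (subprob_algebra (config_space marked_borel))"
proof (rule measurable_config_kernelI)
  interpret \<eta>: prob_space \<eta> by fact
  \<comment> \<open>All index sets are interpreted at once, since the product runs over
    \<open>config_points \<gamma>\<close> with \<gamma> varying.\<close>
  interpret product_prob_space "\<lambda>_. \<eta>" I for I :: "('a \<times> nat) set"
    by unfold_locales
  note meas = measurable_superpose_marks[OF \<eta> countable_config_points]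
  show "prob_space (marked_kernel \<eta> \<gamma>)" if "\<gamma> \<in> space (config_space borel)" for \<gamma>
    unfolding marked_kernel_def using that by (intro P.prob_space_distr meas) simp
  show "sets (marked_kernel \<eta> \<gamma>) = sets (config_space marked_borel)" for \<gamma>
    by (simp add: marked_kernel_def)
  fix g :: "'a \<times> 'a vect \<Rightarrow> ennreal" assume g [measurable]: "g \<in> borel_measurable marked_borel"
  \<comment> \<open>The contribution of one centre to the exponent; it is \<infinity> exactly where
    \<open>g (x, v)\<close> is infinite for almost every mark \<open>v\<close>.\<close>
  define \<phi> where "\<phi> x = neg_ln (\<integral>\<^sup>+ v. ennreal (exp_neg (g (x, v))) \<partial>\<eta>)" for x
  have "(\<integral>\<^sup>+ \<gamma>'. ennreal (exp_neg (\<integral>\<^sup>+ z. g z \<partial>\<gamma>')) \<partial>marked_kernel \<eta> \<gamma>)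
      = ennreal (exp_neg (\<integral>\<^sup>+ x. \<phi> x \<partial>\<gamma>))" if "\<gamma> \<in> space (config_space borel)" for \<gamma>
  proof -
    let ?I = "config_points \<gamma>"
    have \<gamma>: "\<gamma> \<in> gen_configs borel" and I: "countable ?I"
      using that by (auto intro: countable_config_points)
    note [measurable] = measurable_nn_integral_config_space[OF g]
    have "(\<integral>\<^sup>+ \<gamma>'. ennreal (exp_neg (\<integral>\<^sup>+ z. g z \<partial>\<gamma>')) \<partial>marked_kernel \<eta> \<gamma>)
        = (\<integral>\<^sup>+ v. ennreal (exp_neg (\<integral>\<^sup>+ z. g z \<partial>superpose ?I marked_borel
            (\<lambda>(x, k). return marked_borel (x, v (x, k))))) \<partial>(\<Pi>\<^sub>M _\<in>?I. \<eta>))"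
      unfolding marked_kernel_def by (rule nn_integral_distr[OF meas[OF \<gamma>]]) measurable
    also have "\<dots> = (\<integral>\<^sup>+ v. ennreal (exp_neg (\<integral>\<^sup>+ p. g (fst p, v p) \<partial>count_space ?I)) \<partial>(\<Pi>\<^sub>M _\<in>?I. \<eta>))"
    proof (intro nn_integral_cong arg_cong[where f = "\<lambda>t. ennreal (exp_neg t)"])
      fix v assume v: "v \<in> space (\<Pi>\<^sub>M _\<in>?I. \<eta>)"
      have "(\<integral>\<^sup>+ z. g z \<partial>superpose ?I marked_borel (\<lambda>(x, k). return marked_borel (x, v (x, k))))
          = (\<integral>\<^sup>+ p. (\<integral>\<^sup>+ z. g z \<partial>return marked_borel (fst p, v p)) \<partial>count_space ?I)"
        using g by (subst nn_integral_superpose) (auto simp: case_prod_unfold)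
      also have "\<dots> = (\<integral>\<^sup>+ p. g (fst p, v p) \<partial>count_space ?I)"
        using v sets_eq_imp_space_eq[OF \<eta>] g
        by (intro nn_integral_cong nn_integral_return) (auto simp: space_PiM space_marked_borel simp del: space_borel_of)
      finally show "(\<integral>\<^sup>+ z. g z \<partial>superpose ?I marked_borel (\<lambda>(x, k). return marked_borel (x, v (x, k))))
        = (\<integral>\<^sup>+ p. g (fst p, v p) \<partial>count_space ?I)" .
    qed
    also have "\<dots> = ennreal (exp_neg (\<integral>\<^sup>+ p. \<phi> (fst p) \<partial>count_space ?I))"
      unfolding \<phi>_def
      by (intro nn_integral_exp_neg_PiM I measurable_compose[OF _ g]) measurable
    \<comment> \<open>The summand ignores the multiplicity label, so summing over the pairs is
      integrating against \<gamma>.\<close>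
    also have "(\<integral>\<^sup>+ p. \<phi> (fst p) \<partial>count_space ?I) = (\<integral>\<^sup>+ x. \<phi> x \<partial>\<gamma>)"
    proof -
      have "\<phi> \<in> borel_measurable borel"
        unfolding \<phi>_def by measurable
      then show ?thesis
        using nn_integral_config_points[OF \<gamma>, of \<phi>] by (simp add: case_prod_unfold)
    qed
    finally show ?thesis .
  qed
  moreover have "(\<lambda>\<gamma>. ennreal (exp_neg (\<integral>\<^sup>+ x. \<phi> x \<partial>\<gamma>))) \<in> borel_measurable (config_space borel)"
  proof -
    have "\<phi> \<in> borel_measurable borel"
      unfolding \<phi>_def by measurable
    note [measurable] = measurable_nn_integral_config_space[OF this]
    show ?thesis by measurable
  qed
  ultimately show "(\<lambda>\<gamma>. \<integral>\<^sup>+ \<gamma>'. ennreal (exp_neg (\<integral>\<^sup>+ z. g z \<partial>\<gamma>')) \<partial>marked_kernel \<eta> \<gamma>)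
    \<in> borel_measurable (config_space borel)"
    by (subst measurable_cong)
qed

text \<open>Given \<gamma>, both laws are images of the same product of marks: on the cluster side
  by \<open>cluster_at_eq_distr\<close> and \<open>distr_PiM_componentwise\<close>, on the marked
  side by applying \<open>marked_config_lift\<close> to the superposition.\<close>

lemma distr_superpose_cluster_at:
  fixes \<eta> :: "'a::{second_countable_topology, t1_space, topological_monoid_add, group_add} vect measure"
  assumes "prob_space \<eta>" and \<eta> [measurable_cong]: "sets \<eta> = sets vect_borel"
    and \<gamma>: "\<gamma> \<in> gen_configs borel"
  shows "distr (\<Pi>\<^sub>M (x, k)\<in>config_points \<gamma>. cluster_at \<eta> x) (config_space borel)
      (superpose (config_points \<gamma>) borel)
    = distr (marked_kernel \<eta> \<gamma>) (config_space borel) marked_config_lift"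
proof -
  let ?I = "config_points \<gamma>" and ?C = "config_space (borel :: 'a measure)"
  let ?f = "\<lambda>p v. marked_config (fst p, v)"
  have I: "countable ?I" using \<gamma> by (rule countable_config_points)
  have f [measurable]: "?f p \<in> measurable \<eta> ?C" for p
    by (rule measurable_compose[OF _ measurable_marked_config]) measurable
  have super: "superpose ?I borel \<in> measurable (\<Pi>\<^sub>M _\<in>?I. ?C) ?C"
    using measurable_superpose[OF I, of "\<lambda>i \<omega>. \<omega> i" "\<Pi>\<^sub>M _\<in>?I. ?C" borel] by simp
  have "(\<Pi>\<^sub>M (x, k)\<in>?I. cluster_at \<eta> x) = (\<Pi>\<^sub>M p\<in>?I. distr \<eta> ?C (?f p))"
    by (intro PiM_cong refl) (auto simp: cluster_at_eq_distr[OF \<eta>])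
  also have "\<dots> = distr (\<Pi>\<^sub>M _\<in>?I. \<eta>) (\<Pi>\<^sub>M _\<in>?I. ?C) (\<lambda>v. \<lambda>p\<in>?I. ?f p (v p))"
    by (intro distr_PiM_componentwise assms f)
  finally have prod_eq: "(\<Pi>\<^sub>M (x, k)\<in>?I. cluster_at \<eta> x)
    = distr (\<Pi>\<^sub>M _\<in>?I. \<eta>) (\<Pi>\<^sub>M _\<in>?I. ?C) (\<lambda>v. \<lambda>p\<in>?I. ?f p (v p))" .
  have "distr (\<Pi>\<^sub>M (x, k)\<in>?I. cluster_at \<eta> x) ?C (superpose ?I borel)
      = distr (\<Pi>\<^sub>M _\<in>?I. \<eta>) ?C (\<lambda>v. superpose ?I borel (\<lambda>p\<in>?I. ?f p (v p)))"
  proof -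
    have "(\<lambda>v. \<lambda>p\<in>?I. ?f p (v p)) \<in> measurable (\<Pi>\<^sub>M _\<in>?I. \<eta>) (\<Pi>\<^sub>M _\<in>?I. ?C)"
      by (intro measurable_restrict measurable_compose[OF _ f] measurable_component_singleton)
    with super show ?thesis
      by (simp only: prod_eq distr_distr comp_def)
  qed
  also have "\<dots> = distr (\<Pi>\<^sub>M _\<in>?I. \<eta>) ?C (\<lambda>v. marked_config_lift
      (superpose ?I marked_borel (\<lambda>(x, k). return marked_borel (x, v (x, k)))))"
  proof (intro distr_cong refl)
    fix v assume "v \<in> space (\<Pi>\<^sub>M _\<in>?I. \<eta>)"
    then have "(\<lambda>p. (fst p, v p)) \<in> ?I \<rightarrow> space marked_borel"
      using sets_eq_imp_space_eq[OF \<eta>]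
      by (auto simp: space_PiM space_marked_borel simp del: space_borel_of)
    from marked_config_lift_superpose_return[OF I this]
    show "superpose ?I borel (\<lambda>p\<in>?I. ?f p (v p)) = marked_config_lift
        (superpose ?I marked_borel (\<lambda>(x, k). return marked_borel (x, v (x, k))))"
      by (simp add: case_prod_unfold cong: superpose_cong del: marked_config.simps)
  qed
  also have "\<dots> = distr (marked_kernel \<eta> \<gamma>) ?C marked_config_lift"
    unfolding marked_kernel_def
    using distr_distr[OF measurable_marked_config_lift measurable_superpose_marks[OF \<eta> I]]
    by (simp only: comp_def)
  finally show ?thesis .
qed

section \<open>Averaging over the configuration of centres\<close>

theorem theorem2p3:
  fixes \<mu>\<^sub>c :: "'a::{polish_space, real_vector, topological_monoid_add} measure measure"
    and \<eta> :: "'a vect measure"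
  assumes "prob_space \<mu>\<^sub>c" and "sets \<mu>\<^sub>c = sets (config_space borel)"
    and "prob_space \<eta>" and "sets \<eta> = sets vect_borel"
    and "symmetric_vect_measure \<eta>"
  shows "cluster_measure \<mu>\<^sub>c \<eta> =
    distr (marked_measure \<mu>\<^sub>c \<eta>) (config_space borel) marked_config_lift"
proof -
  have space: "space \<mu>\<^sub>c = gen_configs borel"
    using sets_eq_imp_space_eq[OF assms(2)] by simp
  \<comment> \<open>\<open>bind_cong\<close> compares the kernels only on the space of
    \<open>\<mu>\<^sub>c\<close>, which consists of generalized configurations.\<close>
  have "cluster_measure \<mu>\<^sub>c \<eta>
      = Giry_Monad.bind \<mu>\<^sub>c (\<lambda>\<gamma>. distr (marked_kernel \<eta> \<gamma>) (config_space borel) marked_config_lift)"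
    unfolding cluster_measure_def using distr_superpose_cluster_at[OF assms(3,4)]
    by (intro bind_cong refl) (simp add: space)
  \<comment> \<open>Push-forward commutes with the bind because the marking kernel and the lifted
    map are measurable.\<close>
  also have "\<dots> = distr (Giry_Monad.bind \<mu>\<^sub>c (marked_kernel \<eta>)) (config_space borel) marked_config_lift"
  proof (rule distr_bind[symmetric])
    show "marked_kernel \<eta> \<in> measurable \<mu>\<^sub>c (subprob_algebra (config_space marked_borel))"
      using measurable_marked_kernel[OF assms(3,4)] assms(2) by (simp cong: measurable_cong_sets)
    show "space \<mu>\<^sub>c \<noteq> {}"
      using prob_space.not_empty[OF assms(1)] .
    show "marked_config_lift \<in> measurable (config_space marked_borel) (config_space (borel :: 'a measure))"
      by (rule measurable_marked_config_lift)
  qed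
  also have "Giry_Monad.bind \<mu>\<^sub>c (marked_kernel \<eta>) = marked_measure \<mu>\<^sub>c \<eta>"
    unfolding marked_measure_def marked_kernel_def[abs_def] ..
  finally show ?thesis .
qed

end
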